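(* Let $p,q\in(1,\infty)$. Let $X$ be an infinite dimensional Banach space with the $p$-co-Banach-Saks property and not containing $\ell_1$. Let $Y$ be a reflexive asymptotically $q$-uniformly smooth Banach space. Then there is no coarse embedding $f:X\to Y$ such that $\limsup_{k\to\infty}\rho_f(k^{1/p})/k^{1/q}=\infty$.
   Context: For $f:X\to Y$, $\omega_f(t)=\sup\{\|f(x)-f(y)\|:\|x-y\|\le t\}$, $\rho_f(t)=\inf\{\|f(x)-f(y)\|:\|x-y\|\ge t\}$; $f$ is a coarse embedding if $\omega_f(t)<\infty$ for all $t\ge 0$ and $\rho_f(t)\to\infty$ as $t\to\infty$. $X$ has the $p$-co-Banach-Saks property if for every semi-normalized weakly null sequence $(x_n)$ in $X$ there are a subsequence $(x_{n_j})$ and $c>0$ with $\|x_{n_{j_1}}+\dots+x_{n_{j_k}}\|\ge ck^{1/p}$ for all $k$ and all $k\le j_1<\dots<j_k$. $Y$ is asymptotically $q$-uniformly smooth if there is $C>0$ with $\overline\rho_Y(t)\le Ct^q$ for $t\in[0,1]$, where $\overline{\rho}_Y(t)=\sup_{x\in\partial B_Y}\inf_{\dim(Y/E)<\infty}\sup_{h\in\partial B_E}\|x+th\|-1$. *)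

theory Defs
  imports "HOL-Analysis.Analysis" "HOL-Library.Liminf_Limsup"
begin

definition infinite_dimensional :: "'a::real_normed_vector itself \<Rightarrow> bool" where
  "infinite_dimensional _ \<longleftrightarrow> \<not> (\<exists>B::'a set. finite B \<and> span B = UNIV)"

definition weakly_null :: "(nat \<Rightarrow> 'a::real_normed_vector) \<Rightarrow> bool" where
  "weakly_null x \<longleftrightarrow> (\<forall>\<phi>::'a \<Rightarrow> real. bounded_linear \<phi> \<longrightarrow> (\<lambda>n. \<phi> (x n)) \<longlonglongrightarrow> 0)"

definition semi_normalized :: "(nat \<Rightarrow> 'a::real_normed_vector) \<Rightarrow> bool" where
  "semi_normalized x \<longleftrightarrow> (\<exists>a b. 0 < a \<and> a \<le> b \<and> (\<forall>n. a \<le> norm (x n) \<and> norm (x n) \<le> b))"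

text \<open>p-co-Banach-Saks property: for every semi-normalized weakly null sequence there are a
  subsequence \<open>x \<circ> r\<close> and \<open>c > 0\<close> such that for all k and all indices
  \<open>k \<le> j\<^sub>1 < \<dots> < j\<^sub>k\<close> (a set J of k indices, all \<open>\<ge> k\<close>) the sum has norm \<open>\<ge> c k\<^sup>1\<^sup>/\<^sup>p\<close>.\<close>
definition co_banach_saks :: "'a::real_normed_vector itself \<Rightarrow> real \<Rightarrow> bool" where
  "co_banach_saks _ p \<longleftrightarrow>
     (\<forall>x::nat \<Rightarrow> 'a. semi_normalized x \<and> weakly_null x \<longrightarrow>
        (\<exists>r c. strict_mono r \<and> c > 0 \<and>
           (\<forall>k J. finite J \<and> card J = k \<and> (\<forall>j\<in>J. k \<le> j) \<longrightarrow>
              c * real k powr (1 / p) \<le> norm (\<Sum>j\<in>J. x (r j)))))"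

text \<open>X contains (an isomorphic copy of) \<open>\<ell>\<^sub>1\<close>: there is a sequence equivalent to the
  unit vector basis of \<open>\<ell>\<^sub>1\<close>, i.e. the map \<open>a \<mapsto> \<Sum> a\<^sub>i x\<^sub>i\<close> is an isomorphic embedding
  (checked on finitely supported sequences, which are dense in \<open>\<ell>\<^sub>1\<close>).\<close>
definition contains_l1 :: "'a::real_normed_vector itself \<Rightarrow> bool" where
  "contains_l1 _ \<longleftrightarrow> (\<exists>(x::nat \<Rightarrow> 'a) c C. 0 < c \<and>
     (\<forall>(a::nat \<Rightarrow> real) n. c * (\<Sum>i<n. \<bar>a i\<bar>) \<le> norm (\<Sum>i<n. a i *\<^sub>R x i) \<and>
                            norm (\<Sum>i<n. a i *\<^sub>R x i) \<le> C * (\<Sum>i<n. \<bar>a i\<bar>)))"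

definition reflexive_space :: "'a::real_normed_vector itself \<Rightarrow> bool" where
  "reflexive_space _ \<longleftrightarrow>
     (\<forall>\<Phi>::('a \<Rightarrow>\<^sub>L real) \<Rightarrow>\<^sub>L real. \<exists>x::'a. \<forall>\<phi>. blinfun_apply \<Phi> \<phi> = blinfun_apply \<phi> x)"

definition finite_codim :: "'a::real_normed_vector set \<Rightarrow> bool" where
  "finite_codim E \<longleftrightarrow> subspace E \<and> (\<exists>F. finite F \<and> span (E \<union> F) = UNIV)"

text \<open>Modulus of asymptotic uniform smoothness (ereal-valued, so suprema over empty sets are
  \<open>-\<infinity>\<close>; this only matters for finite-dimensional spaces).\<close>
definition aus_modulus :: "'a::real_normed_vector itself \<Rightarrow> real \<Rightarrow> ereal" where
  "aus_modulus _ t = (SUP x\<in>(sphere (0::'a) 1). INF E\<in>{E::'a set. finite_codim E}.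
      SUP h\<in>(sphere 0 1 \<inter> E). ereal (norm (x + t *\<^sub>R h) - 1))"

definition asympt_unif_smooth :: "'a::real_normed_vector itself \<Rightarrow> real \<Rightarrow> bool" where
  "asympt_unif_smooth Y q \<longleftrightarrow> (\<exists>C>0. \<forall>t\<in>{0..1}. aus_modulus Y t \<le> ereal (C * t powr q))"

definition omega :: "('a::real_normed_vector \<Rightarrow> 'b::real_normed_vector) \<Rightarrow> real \<Rightarrow> ereal" where
  "omega f t = Sup {ereal (norm (f x - f y)) | x y. norm (x - y) \<le> t}"

definition rho :: "('a::real_normed_vector \<Rightarrow> 'b::real_normed_vector) \<Rightarrow> real \<Rightarrow> ereal" where
  "rho f t = Inf {ereal (norm (f x - f y)) | x y. norm (x - y) \<ge> t}"

definition coarse_embedding :: "('a::real_normed_vector \<Rightarrow> 'b::real_normed_vector) \<Rightarrow> bool" where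
  "coarse_embedding f \<longleftrightarrow> (\<forall>t\<ge>0. omega f t < \<infinity>) \<and> ((\<lambda>t. rho f t) \<longlongrightarrow> \<infinity>) at_top"

end

theory Submission
  imports Defs "HOL-Library.Diagonal_Subsequence"
begin

text \<open>By Rosenthal's \<open>\<ell>\<^sub>1\<close> theorem \<open>X\<close> contains a semi-normalized weakly null sequence; scaling the
  subsequence given by the co-Banach-Saks property yields \<open>z\<close> with
  \<open>\<parallel>z\<^bsub>n\<^sub>1\<^esub> + \<dots> + z\<^bsub>n\<^sub>k\<^esub>\<parallel> \<ge> 2 k\<^sup>1\<^sup>/\<^sup>p\<close> for \<open>k \<le> n\<^sub>1 < \<dots> < n\<^sub>k\<close>. The map
  \<open>(n\<^sub>1, \<dots>, n\<^sub>k) \<mapsto> f (z\<^bsub>n\<^sub>1\<^esub> + \<dots> + z\<^bsub>n\<^sub>k\<^esub>)\<close> moves by at most a constant \<open>L\<close> when one coordinate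
  changes, so, as for the Kalton-Randrianarivony theorem, taking weak limits of the coordinates
  along a free ultrafilter \<open>U\<close> writes it as a constant plus \<open>k\<close> successively weakly null
  increments of norm at most \<open>L\<close>. Asymptotic smoothness bounds their sum by \<open>K L k\<^sup>1\<^sup>/\<^sup>q\<close> for
  \<open>U\<close>-most \<open>n\<^sub>1\<close>, \<open>U\<close>-most \<open>n\<^sub>2\<close>, and so on. Choosing a second tuple on which a functional norming the
  first sum is small gives two points of \<open>X\<close> at distance at least \<open>k\<^sup>1\<^sup>/\<^sup>p\<close> whose images are
  \<open>2 K L k\<^sup>1\<^sup>/\<^sup>q\<close>-close. Quantifying along \<open>U\<close> replaces the usual passage to an infinite subset
  of the natural numbers.\<close>

section \<open>The Hahn-Banach theorem\<close>

text \<open>Homogeneity is demanded only as an inequality, which is easy to verify for infima;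
  \<open>sublinear_scale\<close> recovers the equality.\<close>

definition sublinear :: "('a::real_vector \<Rightarrow> real) \<Rightarrow> bool" where
  "sublinear p \<longleftrightarrow> (\<forall>x y. p (x + y) \<le> p x + p y) \<and> (\<forall>t\<ge>0. \<forall>x. p (t *\<^sub>R x) \<le> t * p x)"

lemma sublinear_add: "sublinear p \<Longrightarrow> p (x + y) \<le> p x + p y"
  by (simp add: sublinear_def)

lemma sublinear_0:
  assumes "sublinear p"
  shows "p 0 = 0"
proof -
  have "p (0 *\<^sub>R 0) \<le> 0 * p 0"
    using assms unfolding sublinear_def by blast
  moreover have "p (0 + 0) \<le> p 0 + p 0"
    using assms by (rule sublinear_add)
  ultimately show ?thesis by simp
qed

lemma sublinear_scale:
  assumes "sublinear p" "0 \<le> t"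
  shows "p (t *\<^sub>R x) = t * p x"
proof (cases "t = 0")
  case True
  then show ?thesis using sublinear_0[OF assms(1)] by simp
next
  case False
  then have "t > 0" using assms by simp
  have "p (inverse t *\<^sub>R (t *\<^sub>R x)) \<le> inverse t * p (t *\<^sub>R x)"
    using assms \<open>t > 0\<close> unfolding sublinear_def by (metis inverse_nonnegative_iff_nonnegative)
  then have "t * p x \<le> p (t *\<^sub>R x)"
    using \<open>t > 0\<close> by (simp add: field_simps)
  moreover have "p (t *\<^sub>R x) \<le> t * p x"
    using assms unfolding sublinear_def by blast
  ultimately show ?thesis by simp
qed

lemma sublinear_neg: "sublinear p \<Longrightarrow> - p (- x) \<le> p x"
  using sublinear_add[of p x "- x"] sublinear_0[of p] by simp

text \<open>The witness is the infimum over \<open>t \<ge> 0\<close> of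
  \<open>q (x + t *\<^sub>R v) - t * q v\<close>. The choice \<open>t = 0\<close> keeps it below
  \<open>q\<close>, the choice \<open>t = 1\<close> at \<open>x = - v\<close> gives
  \<open>- q v\<close>, and the lower bound \<open>- q (- x)\<close> makes the infimum
  finite.\<close>

lemma sublinear_shift:
  fixes q :: "'a::real_vector \<Rightarrow> real"
  assumes q: "sublinear q"
  obtains r where "sublinear r" "\<And>x. r x \<le> q x" "r (- v) \<le> - q v"
proof -
  define r where "r x = (INF t\<in>{0..}. q (x + t *\<^sub>R v) - t * q v)" for x
  have lower: "- q (- x) \<le> q (x + t *\<^sub>R v) - t * q v" if "0 \<le> t" for x t
    using sublinear_add[OF q, of "x + t *\<^sub>R v" "- x"] sublinear_scale[OF q that] by simp
  have bdd: "bdd_below ((\<lambda>t. q (x + t *\<^sub>R v) - t * q v) ` {0..})" for x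
    by (rule bdd_belowI2[of _ "- q (- x)"]) (use lower in auto)
  have upper: "r x \<le> q (x + t *\<^sub>R v) - t * q v" if "0 \<le> t" for x t
    unfolding r_def by (rule cINF_lower[OF bdd]) (use that in auto)
  have greatest: "c \<le> r x" if "\<And>t. 0 \<le> t \<Longrightarrow> c \<le> q (x + t *\<^sub>R v) - t * q v" for c x
    unfolding r_def by (rule cINF_greatest) (use that in auto)
  have add: "r (x + y) \<le> r x + r y" for x y
  proof -
    have "r (x + y) \<le> (q (x + s *\<^sub>R v) - s * q v) + (q (y + t *\<^sub>R v) - t * q v)"
      if "0 \<le> s" "0 \<le> t" for s t
    proof -
      have "r (x + y) \<le> q (x + y + (s + t) *\<^sub>R v) - (s + t) * q v"
        using that by (intro upper) auto
      also have "x + y + (s + t) *\<^sub>R v = (x + s *\<^sub>R v) + (y + t *\<^sub>R v)"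
        by (simp add: algebra_simps)
      finally show ?thesis
        using sublinear_add[OF q, of "x + s *\<^sub>R v" "y + t *\<^sub>R v"] by (simp add: algebra_simps)
    qed
    note * = this
    \<comment> \<open>The two infima are taken one at a time: over \<open>t\<close> for fixed
      \<open>s\<close> here, over \<open>s\<close> afterwards.\<close>
    have "r (x + y) - (q (x + s *\<^sub>R v) - s * q v) \<le> r y" if "0 \<le> s" for s
    proof (rule greatest)
      show "r (x + y) - (q (x + s *\<^sub>R v) - s * q v) \<le> q (y + t *\<^sub>R v) - t * q v" if "0 \<le> t" for t
        using *[OF \<open>0 \<le> s\<close> that] by linarith
    qed
    then have "r (x + y) - r y \<le> r x"
      by (intro greatest) (simp add: algebra_simps)
    then show ?thesis by simp
  qed
  have scale: "r (c *\<^sub>R x) \<le> c * r x" if c: "0 \<le> c" for c x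
  proof (cases "c = 0")
    case True
    have "r 0 \<le> 0" using upper[of 0 0] sublinear_0[OF q] by simp
    then show ?thesis using True by simp
  next
    case False
    have "r (c *\<^sub>R x) / c \<le> r x"
    proof (rule greatest)
      fix t :: real assume t: "0 \<le> t"
      have "r (c *\<^sub>R x) \<le> q (c *\<^sub>R x + (c * t) *\<^sub>R v) - (c * t) * q v"
        using c t by (intro upper) auto
      also have "c *\<^sub>R x + (c * t) *\<^sub>R v = c *\<^sub>R (x + t *\<^sub>R v)"
        by (simp add: algebra_simps)
      finally have "r (c *\<^sub>R x) \<le> c * (q (x + t *\<^sub>R v) - t * q v)"
        unfolding sublinear_scale[OF q c] by (simp add: algebra_simps)
      then show "r (c *\<^sub>R x) / c \<le> q (x + t *\<^sub>R v) - t * q v"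
        using c False by (simp add: divide_le_eq mult.commute)
    qed
    then show ?thesis using c False by (simp add: field_simps)
  qed
  show thesis
  proof
    show "sublinear r" using add scale by (auto simp: sublinear_def)
    show "r x \<le> q x" for x using upper[of 0 x] by simp
    show "r (- v) \<le> - q v" using upper[of 1 "- v"] sublinear_0[OF q] by simp
  qed
qed

text \<open>A minimal sublinear functional below \<open>p\<close> is linear: otherwise
  \<open>sublinear_shift\<close> makes it smaller.\<close>
lemma sublinear_dominates_linear:
  fixes p :: "'a::real_vector \<Rightarrow> real"
  assumes p: "sublinear p"
  obtains \<phi> where "linear \<phi>" "\<And>x. \<phi> x \<le> p x"
proof -
  define A where "A = {q. sublinear q \<and> q \<le> p}"
  \<comment> \<open>Zorn's lemma for the reversed pointwise order, so that maximal means minimal;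
    the pointwise infimum of a nonempty chain is the required bound.\<close>
  have "\<exists>m\<in>A. \<forall>a\<in>A. a \<le> m \<longrightarrow> a = m"
  proof (rule predicate_Zorn)
    show "partial_order_on A (relation_of (\<lambda>x y. y \<le> x) A)"
      by (rule partial_order_on_relation_ofI) auto
  next
    fix C assume C: "C \<in> Chains (relation_of (\<lambda>x y. y \<le> x) A)"
    have CA: "C \<subseteq> A" and chain: "\<And>a b. a \<in> C \<Longrightarrow> b \<in> C \<Longrightarrow> a \<le> b \<or> b \<le> a"
      using C by (auto simp: Chains_def relation_of_def)
    show "\<exists>u\<in>A. \<forall>a\<in>C. u \<le> a"
    proof (cases "C = {}")
      case True
      then show ?thesis using p by (auto simp: A_def)
    next
      case False
      define m where "m x = (INF q\<in>C. q x)" for x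
      have sub: "sublinear q" "q x \<le> p x" if "q \<in> C" for q x
        using that CA by (auto simp: A_def le_fun_def)
      have bdd: "bdd_below ((\<lambda>q. q x) ` C)" for x
      proof (rule bdd_belowI2)
        show "- p (- x) \<le> q x" if "q \<in> C" for q
          using sublinear_neg[OF sub(1)[OF that], of x] sub(2)[OF that, of "- x"] by simp
      qed
      have upper: "m x \<le> q x" if "q \<in> C" for q x
        unfolding m_def by (rule cINF_lower[OF bdd that])
      have greatest: "c \<le> m x" if "\<And>q. q \<in> C \<Longrightarrow> c \<le> q x" for c x
        unfolding m_def by (rule cINF_greatest) (use that False in auto)
      have add: "m (x + y) \<le> m x + m y" for x y
      proof -
        \<comment> \<open>Subadditivity survives the infimum because two members of a chain have the
          smaller one as a common lower bound.\<close>
        have *: "m (x + y) \<le> q1 x + q2 y" if q12: "q1 \<in> C" "q2 \<in> C" for q1 q2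
        proof -
          obtain q where q: "q \<in> C" "q \<le> q1" "q \<le> q2"
            using chain[OF q12] q12 by auto
          have "m (x + y) \<le> q x + q y"
            using upper[OF q(1)] sublinear_add[OF sub(1)[OF q(1)]] order_trans by blast
          then show ?thesis using le_funD[OF q(2), of x] le_funD[OF q(3), of y] by linarith
        qed
        have "m (x + y) - q1 x \<le> m y" if "q1 \<in> C" for q1
        proof (rule greatest)
          show "m (x + y) - q1 x \<le> q2 y" if "q2 \<in> C" for q2
            using *[OF \<open>q1 \<in> C\<close> that] by linarith
        qed
        then have "m (x + y) - m y \<le> m x"
          by (intro greatest) (simp add: algebra_simps)
        then show ?thesis by simp
      qed
      have scale: "m (t *\<^sub>R x) \<le> t * m x" if t: "0 \<le> t" for t x
      proof (cases "t = 0")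
        case True
        obtain q where "q \<in> C" using False by auto
        then have "m 0 \<le> 0" using upper sublinear_0[OF sub(1)] by metis
        then show ?thesis using True by simp
      next
        case False
        have "m (t *\<^sub>R x) / t \<le> m x"
        proof (rule greatest)
          fix q assume "q \<in> C"
          then have "m (t *\<^sub>R x) \<le> t * q x"
            using upper sublinear_scale[OF sub(1) t] by metis
          then show "m (t *\<^sub>R x) / t \<le> q x" using t False by (simp add: field_simps)
        qed
        then show ?thesis using t False by (simp add: field_simps)
      qed
      have "m x \<le> p x" for x
        using False upper sub(2) order_trans by (metis ex_in_conv)
      then have "m \<in> A"
        using add scale by (auto simp: A_def sublinear_def le_fun_def)
      then show ?thesis using upper by (auto simp: le_fun_def)
    qed
  qed
  then obtain m where mA: "m \<in> A" and min: "\<And>a. a \<in> A \<Longrightarrow> a \<le> m \<Longrightarrow> a = m"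
    by blast
  have m: "sublinear m" "\<And>x. m x \<le> p x"
    using mA by (auto simp: A_def le_fun_def)
  have neg: "m (- v) = - m v" for v
  proof -
    obtain r where r: "sublinear r" "\<And>x. r x \<le> m x" "r (- v) \<le> - m v"
      using sublinear_shift[OF m(1), of v] by blast
    have "r = m"
      using r(2) m(2) order_trans
      by (intro min) (auto simp: A_def le_fun_def r(1) intro: order_trans)
    then show ?thesis using r(3) sublinear_neg[OF m(1), of v] by simp
  qed
  have add: "m (x + y) = m x + m y" for x y
    using sublinear_add[OF m(1), of x y] sublinear_add[OF m(1), of "- x" "- y"]
      neg[of x] neg[of y] neg[of "x + y"] by simp
  have "linear m"
  proof (rule linearI)
    show "m (c *\<^sub>R x) = c *\<^sub>R m x" for c x
      using sublinear_scale[OF m(1), of c x] sublinear_scale[OF m(1), of "- c" x] neg[of "c *\<^sub>R x"]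
      by (cases "0 \<le> c") auto
  qed (rule add)
  then show thesis using m(2) that by blast
qed

text \<open>A linear functional below the shift of \<open>p\<close> at \<open>v\<close> is at most
  \<open>- p v\<close> at \<open>- v\<close>, hence at least \<open>p v\<close> at
  \<open>v\<close>.\<close>

lemma Hahn_Banach_point:
  fixes p :: "'a::real_vector \<Rightarrow> real"
  assumes p: "sublinear p"
  obtains \<phi> where "linear \<phi>" "\<And>x. \<phi> x \<le> p x" "\<phi> v = p v"
proof -
  obtain r where r: "sublinear r" "\<And>x. r x \<le> p x" "r (- v) \<le> - p v"
    using sublinear_shift[OF p, of v] by blast
  obtain \<phi> where \<phi>: "linear \<phi>" "\<And>x. \<phi> x \<le> r x"
    using sublinear_dominates_linear[OF r(1)] by blast
  have "p v \<le> \<phi> v"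
    using \<phi>(2)[of "- v"] r(3) linear_neg[OF \<phi>(1), of v] by simp
  moreover have "\<phi> x \<le> p x" for x
    using \<phi>(2) r(2) order_trans by blast
  ultimately show thesis
    using that[OF \<phi>(1)] by (metis antisym)
qed

lemma norming_functional:
  fixes v :: "'a::real_normed_vector"
  obtains \<phi> :: "'a \<Rightarrow> real" where "bounded_linear \<phi>" "\<And>x. \<bar>\<phi> x\<bar> \<le> norm x" "\<phi> v = norm v"
proof -
  have "sublinear (norm :: 'a \<Rightarrow> real)"
    by (auto simp: sublinear_def norm_triangle_ineq)
  then obtain \<phi> :: "'a \<Rightarrow> real" where \<phi>: "linear \<phi>" "\<And>x. \<phi> x \<le> norm x" "\<phi> v = norm v"
    using Hahn_Banach_point[of norm v] by blast
  have "\<bar>\<phi> x\<bar> \<le> norm x" for x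
    using \<phi>(2)[of x] \<phi>(2)[of "- x"] linear_neg[OF \<phi>(1), of x] by (simp add: abs_le_iff)
  moreover from this have "bounded_linear \<phi>"
    using \<phi>(1) by (intro bounded_linear_intro[of _ 1]) (auto simp: linear_add linear_cmul)
  ultimately show thesis using \<phi>(3) that by blast
qed

section \<open>Separation from closed subspaces and closedness of finite-dimensional spans\<close>

lemma infdist_subspace_sublinear:
  fixes E :: "'a::real_normed_vector set"
  assumes E: "subspace E"
  shows "sublinear (\<lambda>x. infdist x E)"
proof -
  have ne: "E \<noteq> {}" using subspace_0[OF E] by auto
  have near: "\<exists>a\<in>E. norm (x - a) < infdist x E + \<epsilon>" if "\<epsilon> > 0" for x \<epsilon>
  proof -
    have "(INF a\<in>E. dist x a) < infdist x E + \<epsilon>"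
      using that ne by (simp add: infdist_notempty)
    then show ?thesis
      using ne by (subst (asm) cINF_less_iff) (auto simp: dist_norm intro!: bdd_belowI2[of _ 0])
  qed
  have "infdist (x + y) E \<le> infdist x E + infdist y E" for x y
  proof (rule field_le_epsilon)
    fix \<epsilon> :: real assume "\<epsilon> > 0"
    then obtain a b where ab: "a \<in> E" "b \<in> E" "norm (x - a) < infdist x E + \<epsilon> / 2"
      "norm (y - b) < infdist y E + \<epsilon> / 2"
      using near[of "\<epsilon> / 2" x] near[of "\<epsilon> / 2" y] by auto
    have "infdist (x + y) E \<le> norm ((x - a) + (y - b))"
      using infdist_le[OF subspace_add[OF E ab(1,2)], of "x + y"]
      by (simp add: dist_norm algebra_simps)
    then show "infdist (x + y) E \<le> infdist x E + infdist y E + \<epsilon>"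
      using norm_triangle_ineq[of "x - a" "y - b"] ab by linarith
  qed
  moreover have "infdist (t *\<^sub>R x) E \<le> t * infdist x E" if t: "0 \<le> t" for t x
  proof (cases "t = 0")
    case True
    then show ?thesis using subspace_0[OF E] by simp
  next
    case False
    have "infdist (t *\<^sub>R x) E / t \<le> (INF a\<in>E. dist x a)"
    proof (rule cINF_greatest[OF ne])
      fix a assume "a \<in> E"
      then have "infdist (t *\<^sub>R x) E \<le> norm (t *\<^sub>R x - t *\<^sub>R a)"
        using infdist_le[OF subspace_scale[OF E]] by (metis dist_norm)
      also have "\<dots> = t * norm (x - a)"
        using t by (simp add: scaleR_diff_right[symmetric])
      finally show "infdist (t *\<^sub>R x) E / t \<le> dist x a"
        using t False by (simp add: field_simps dist_norm)
    qed
    then show ?thesis using t False ne by (simp add: infdist_notempty field_simps)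
  qed
  ultimately show ?thesis by (auto simp: sublinear_def)
qed

text \<open>Hahn-Banach is applied to the distance from \<open>E\<close>: domination by it forces
  the functional to vanish on \<open>E\<close>, and closedness of \<open>E\<close> makes its value
  at \<open>v\<close> positive, so it can be normalized to 1.\<close>

lemma separating_functional:
  fixes E :: "'a::real_normed_vector set"
  assumes E: "subspace E" "closed E" and v: "v \<notin> E"
  obtains \<phi> :: "'a \<Rightarrow> real" where "bounded_linear \<phi>" "\<And>e. e \<in> E \<Longrightarrow> \<phi> e = 0" "\<phi> v = 1"
proof -
  define d where "d = infdist v E"
  have d: "d > 0"
    unfolding d_def using E v subspace_0 by (intro infdist_pos_not_in_closed) auto
  obtain \<phi> :: "'a \<Rightarrow> real" where \<phi>: "linear \<phi>" "\<And>x. \<phi> x \<le> infdist x E" "\<phi> v = infdist v E"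
    using Hahn_Banach_point[OF infdist_subspace_sublinear[OF E(1)], of v] by blast
  have "infdist x E \<le> norm x" for x
    using infdist_le[OF subspace_0[OF E(1)], of x] by simp
  then have "\<phi> x \<le> norm x" for x using \<phi>(2) order_trans by blast
  then have "\<bar>\<phi> x\<bar> \<le> norm x" for x
    using linear_neg[OF \<phi>(1), of x] by (metis abs_le_iff norm_minus_cancel)
  then have bl: "bounded_linear \<phi>"
    using \<phi>(1) by (intro bounded_linear_intro[of _ 1]) (auto simp: linear_add linear_cmul)
  have "\<phi> e = 0" if "e \<in> E" for e
    using \<phi>(2)[of e] \<phi>(2)[of "- e"] that subspace_neg[OF E(1) that] linear_neg[OF \<phi>(1), of e]
    by simp
  moreover have "bounded_linear (\<lambda>x. \<phi> x / d)"
    using bounded_linear_compose[OF bounded_linear_divide bl] by simp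
  ultimately show thesis
    using \<phi>(3) d that[of "\<lambda>x. \<phi> x / d"] by (simp add: d_def)
qed

text \<open>For \<open>v\<close> outside \<open>E\<close>, a separating functional
  \<open>\<phi>\<close> exhibits the span as the preimage of \<open>E\<close> under the continuous
  map subtracting \<open>\<phi> y\<close> times \<open>v\<close>.\<close>

lemma closed_span_insert:
  fixes E :: "'a::real_normed_vector set"
  assumes E: "subspace E" "closed E"
  shows "closed (span (insert v E))"
proof (cases "v \<in> E")
  case True
  then show ?thesis using E by (simp add: insert_absorb span_eq_iff[THEN iffD2])
next
  case False
  obtain \<phi> :: "'a \<Rightarrow> real" where \<phi>: "bounded_linear \<phi>" "\<And>e. e \<in> E \<Longrightarrow> \<phi> e = 0" "\<phi> v = 1"
    using separating_functional[OF E False] by blast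
  interpret \<phi>: bounded_linear \<phi> by (rule \<phi>(1))
  have "span (insert v E) = (\<lambda>y. y - \<phi> y *\<^sub>R v) -` E"
  proof (intro equalityI subsetI)
    fix y assume "y \<in> span (insert v E)"
    then obtain k where k: "y - k *\<^sub>R v \<in> E"
      using E(1) by (auto simp: span_insert span_eq_iff[THEN iffD2])
    have "\<phi> (y - k *\<^sub>R v) = 0" using k \<phi>(2) by blast
    then have "\<phi> y = k" using \<phi>(3) by (simp add: \<phi>.diff \<phi>.scaleR)
    then show "y \<in> (\<lambda>y. y - \<phi> y *\<^sub>R v) -` E" using k by simp
  qed (use E(1) in \<open>auto simp: span_insert span_eq_iff[THEN iffD2]\<close>)
  moreover have "closed ((\<lambda>y. y - \<phi> y *\<^sub>R v) -` E)"
    by (intro closed_vimage E continuous_intros \<phi>.continuous_on)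
  ultimately show ?thesis by simp
qed

lemma closed_span_finite:
  fixes F :: "'a::real_normed_vector set"
  assumes "finite F"
  shows "closed (span F)"
  using assms
proof (induction F)
  case (insert v F)
  have "span (insert v F) = span (insert v (span F))"
    by (simp add: span_insert span_span)
  then show ?case using closed_span_insert[OF subspace_span insert.IH] by simp
qed simp

section \<open>Weak limits along ultrafilters and asymptotic smoothness\<close>

text \<open>Lying below \<open>sequentially\<close> says that every cofinite set belongs to
  \<open>U\<close>. Working with filters makes \<open>eventually\<close> and limits along
  \<open>U\<close> available directly.\<close>

definition free_ultrafilter :: "nat filter \<Rightarrow> bool" where
  "free_ultrafilter U \<longleftrightarrow> U \<noteq> bot \<and> U \<le> sequentially \<and>
     (\<forall>P. eventually P U \<or> eventually (\<lambda>n. \<not> P n) U)"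

text \<open>A minimal proper filter below \<open>sequentially\<close> exists by Zorn, since the
  infimum of a chain has the chain as a base and stays proper. Restricting it to a set whose
  complement is not in it gives a proper filter again, which by minimality is the same one.\<close>

lemma free_ultrafilter_exists: "\<exists>U. free_ultrafilter U"
proof -
  define A where "A = {F :: nat filter. F \<noteq> bot \<and> F \<le> sequentially}"
  have "\<exists>m\<in>A. \<forall>a\<in>A. a \<le> m \<longrightarrow> a = m"
  proof (rule predicate_Zorn)
    show "partial_order_on A (relation_of (\<lambda>x y. y \<le> x) A)"
      by (rule partial_order_on_relation_ofI) auto
  next
    fix C assume C: "C \<in> Chains (relation_of (\<lambda>x y. y \<le> x) A)"
    have CA: "C \<subseteq> A" and chain: "\<And>a b. a \<in> C \<Longrightarrow> b \<in> C \<Longrightarrow> a \<le> b \<or> b \<le> a"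
      using C by (auto simp: Chains_def relation_of_def)
    show "\<exists>u\<in>A. \<forall>a\<in>C. u \<le> a"
    proof (cases "C = {}")
      case True
      then show ?thesis by (auto simp: A_def intro!: exI[of _ sequentially])
    next
      case False
      have "\<exists>x\<in>C. x \<le> inf F G" if "F \<in> C" "G \<in> C" for F G
        using chain[OF that] that by (auto simp: inf_absorb1 inf_absorb2)
      then have "eventually P (Inf C) \<longleftrightarrow> (\<exists>b\<in>C. eventually P b)" for P
        using eventually_Inf_base[OF False] by blast
      then have "Inf C \<noteq> bot"
        using CA by (auto simp: A_def trivial_limit_def)
      moreover have "Inf C \<le> sequentially"
        using False CA by (auto simp: A_def intro: Inf_lower2)
      ultimately show ?thesis by (auto simp: A_def intro: Inf_lower)
    qed
  qed
  then obtain U where U: "U \<noteq> bot" "U \<le> sequentially"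
    and min: "\<And>a. a \<in> A \<Longrightarrow> a \<le> U \<Longrightarrow> a = U"
    by (auto simp: A_def)
  have "eventually P U \<or> eventually (\<lambda>n. \<not> P n) U" for P
  proof (rule disjCI)
    assume "\<not> eventually (\<lambda>n. \<not> P n) U"
    then have "inf U (principal {n. P n}) \<noteq> bot"
      by (simp add: trivial_limit_def eventually_inf_principal)
    then have "inf U (principal {n. P n}) = U"
      using U(2) by (intro min) (auto simp: A_def intro: le_infI1)
    moreover have "eventually P (inf U (principal {n. P n}))"
      by (simp add: eventually_inf_principal)
    ultimately show "eventually P U" by simp
  qed
  then show ?thesis using U by (auto simp: free_ultrafilter_def)
qed

text \<open>Compactness of an interval gives the image filter a cluster point, and the ultrafilter
  dichotomy turns a cluster point into a limit.\<close>

lemma free_ultrafilter_bounded_convergent: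
  fixes g :: "nat \<Rightarrow> real"
  assumes U: "free_ultrafilter U" and B: "\<And>n. \<bar>g n\<bar> \<le> B"
  shows "\<exists>l. (g \<longlongrightarrow> l) U"
proof -
  have "filtermap g U \<noteq> bot" "filtermap g U \<le> principal {-B..B}"
    using U B by (auto simp: free_ultrafilter_def filtermap_bot_iff le_principal eventually_filtermap
        abs_le_iff minus_le_iff)
  then obtain l where l: "inf (nhds l) (filtermap g U) \<noteq> bot"
    using compact_Icc[of "-B" B] unfolding compact_filter le_principal by blast
  have "eventually (\<lambda>n. P (g n)) U" if P: "eventually P (nhds l)" for P
  proof (rule ccontr)
    assume "\<not> eventually (\<lambda>n. P (g n)) U"
    then have "eventually (\<lambda>n. \<not> P (g n)) U"
      using U unfolding free_ultrafilter_def by blast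
    then have "eventually (\<lambda>x. \<not> P x) (filtermap g U)"
      by (simp add: eventually_filtermap)
    then have "eventually (\<lambda>x. False) (inf (nhds l) (filtermap g U))"
      using P unfolding eventually_inf by blast
    then show False using l by (simp add: trivial_limit_def)
  qed
  then show ?thesis
    by (auto simp: filterlim_def le_filter_def eventually_filtermap)
qed

text \<open>The limits along \<open>U\<close> of all functionals on the sequence form an element of
  the bidual, which reflexivity represents by a vector.\<close>

lemma reflexive_weak_limit:
  fixes g :: "nat \<Rightarrow> 'b::real_normed_vector"
  assumes refl: "reflexive_space TYPE('b)" and U: "free_ultrafilter U"
    and B: "\<And>n. norm (g n) \<le> B"
  shows "\<exists>y. \<forall>\<phi> :: 'b \<Rightarrow> real. bounded_linear \<phi> \<longrightarrow> ((\<lambda>n. \<phi> (g n)) \<longlongrightarrow> \<phi> y) U"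
proof -
  have nb: "U \<noteq> bot" using U by (simp add: free_ultrafilter_def)
  have bd: "\<bar>blinfun_apply \<phi> (g n)\<bar> \<le> norm \<phi> * B" for \<phi> :: "'b \<Rightarrow>\<^sub>L real" and n
    using order_trans[OF norm_blinfun[of \<phi> "g n"] mult_left_mono[OF B[of n], of "norm \<phi>"]]
    by simp
  then have "\<exists>l. ((\<lambda>n. blinfun_apply \<phi> (g n)) \<longlongrightarrow> l) U" for \<phi> :: "'b \<Rightarrow>\<^sub>L real"
    by (rule free_ultrafilter_bounded_convergent[OF U])
  then obtain \<Phi> :: "('b \<Rightarrow>\<^sub>L real) \<Rightarrow> real"
    where \<Phi>: "\<And>\<phi>. ((\<lambda>n. blinfun_apply \<phi> (g n)) \<longlongrightarrow> \<Phi> \<phi>) U"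
    by metis
  have "bounded_linear \<Phi>"
  proof (rule bounded_linear_intro)
    show "\<Phi> (\<phi> + \<psi>) = \<Phi> \<phi> + \<Phi> \<psi>" for \<phi> \<psi>
      using tendsto_add[OF \<Phi>[of \<phi>] \<Phi>[of \<psi>]]
      by (intro tendsto_unique[OF nb \<Phi>]) (simp add: blinfun.add_left)
    show "\<Phi> (c *\<^sub>R \<phi>) = c *\<^sub>R \<Phi> \<phi>" for c \<phi>
      using tendsto_scaleR[OF tendsto_const[of c] \<Phi>[of \<phi>]]
      by (intro tendsto_unique[OF nb \<Phi>]) (simp add: blinfun.scaleR_left)
    show "norm (\<Phi> \<phi>) \<le> norm \<phi> * B" for \<phi>
      using tendsto_norm[OF \<Phi>[of \<phi>]] nb bd[of \<phi>]
      by (intro tendsto_upperbound[where F = U and f = "\<lambda>n. norm (blinfun_apply \<phi> (g n))"]) auto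
  qed
  then obtain y where y: "\<And>\<phi>. \<Phi> \<phi> = blinfun_apply \<phi> y"
    using refl[unfolded reflexive_space_def, rule_format, of "Blinfun \<Phi>"]
    by (auto simp: bounded_linear_Blinfun_apply)
  have "((\<lambda>n. \<phi> (g n)) \<longlongrightarrow> \<phi> y) U" if "bounded_linear \<phi>" for \<phi> :: "'b \<Rightarrow> real"
    using \<Phi>[of "Blinfun \<phi>"] y that by (simp add: bounded_linear_Blinfun_apply)
  then show ?thesis by blast
qed

text \<open>Balls are weakly closed: the bound is tested on a functional norming the limit.\<close>

lemma norm_weak_limit_le:
  fixes g :: "'i \<Rightarrow> 'b::real_normed_vector"
  assumes lim: "\<And>\<phi> :: 'b \<Rightarrow> real. bounded_linear \<phi> \<Longrightarrow> ((\<lambda>n. \<phi> (g n)) \<longlongrightarrow> \<phi> y) F"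
    and "F \<noteq> bot" and L: "\<And>n. norm (g n) \<le> L"
  shows "norm y \<le> L"
proof -
  obtain \<phi> :: "'b \<Rightarrow> real" where \<phi>: "bounded_linear \<phi>" "\<And>x. \<bar>\<phi> x\<bar> \<le> norm x" "\<phi> y = norm y"
    using norming_functional[of y] by blast
  have "\<phi> (g n) \<le> L" for n
    using \<phi>(2)[of "g n"] L[of n] by linarith
  then have "\<phi> y \<le> L"
    using tendsto_upperbound[OF lim[OF \<phi>(1)] _ \<open>F \<noteq> bot\<close>] by simp
  then show ?thesis using \<phi>(3) by simp
qed

lemma weakly_null_close_to_closed_finite_codim:
  fixes d :: "'i \<Rightarrow> 'b::real_normed_vector"
  assumes "finite F" "subspace E" "closed E" "span (E \<union> F) = UNIV"
    and d: "\<And>\<phi> :: 'b \<Rightarrow> real. bounded_linear \<phi> \<Longrightarrow> ((\<lambda>n. \<phi> (d n)) \<longlongrightarrow> 0) U"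
  shows "\<exists>e. (\<forall>n. e n \<in> E) \<and> ((\<lambda>n. d n - e n) \<longlongrightarrow> 0) U"
  using assms(1-4)
proof (induction F arbitrary: E)
  case empty
  then have "E = UNIV" by (simp add: span_eq_iff[THEN iffD2])
  then show ?case by (intro exI[of _ d]) simp
next
  case (insert v F)
  show ?case
  proof (cases "v \<in> E")
    case True
    then have "E \<union> insert v F = E \<union> F" by auto
    then show ?thesis using insert by auto
  next
    case False
    let ?E' = "span (insert v E)"
    have "E \<union> insert v F \<subseteq> ?E' \<union> F"
      using span_superset[of "insert v E"] by auto
    then have "span (?E' \<union> F) = UNIV"
      using insert.prems(3) span_mono[of "E \<union> insert v F" "?E' \<union> F"] by auto
    then have "\<exists>e'. (\<forall>n. e' n \<in> ?E') \<and> ((\<lambda>n. d n - e' n) \<longlongrightarrow> 0) U"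
      by (rule insert.IH[OF subspace_span closed_span_insert[OF insert.prems(1,2)]])
    then obtain e' where e': "\<And>n. e' n \<in> ?E'" "((\<lambda>n. d n - e' n) \<longlongrightarrow> 0) U"
      by metis
    obtain \<phi> :: "'b \<Rightarrow> real" where \<phi>: "bounded_linear \<phi>" "\<And>e. e \<in> E \<Longrightarrow> \<phi> e = 0" "\<phi> v = 1"
      using separating_functional[OF insert.prems(1,2) False] by blast
    interpret \<phi>: bounded_linear \<phi> by (rule \<phi>(1))
    define e where "e n = e' n - \<phi> (e' n) *\<^sub>R v" for n
    have "e n \<in> E" for n
    proof -
      obtain k where k: "e' n - k *\<^sub>R v \<in> E"
        using e'(1)[of n] insert.prems(1) by (auto simp: span_insert span_eq_iff[THEN iffD2])
      have "\<phi> (e' n - k *\<^sub>R v) = 0" using k \<phi>(2) by blast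
      then have "\<phi> (e' n) = k" using \<phi>(3) by (simp add: \<phi>.diff \<phi>.scaleR)
      then show ?thesis using k by (simp add: e_def)
    qed
    moreover have "((\<lambda>n. d n - e n) \<longlongrightarrow> 0) U"
    proof -
      have "((\<lambda>n. \<phi> (d n) - \<phi> (d n - e' n)) \<longlongrightarrow> 0 - \<phi> 0) U"
        by (intro tendsto_diff d[OF \<phi>(1)] \<phi>.tendsto e'(2))
      then have "((\<lambda>n. \<phi> (e' n)) \<longlongrightarrow> 0) U"
        by (simp add: \<phi>.diff \<phi>.zero)
      then have "((\<lambda>n. (d n - e' n) + \<phi> (e' n) *\<^sub>R v) \<longlongrightarrow> 0 + 0 *\<^sub>R v) U"
        by (intro tendsto_intros e'(2))
      then show ?thesis by (simp add: e_def algebra_simps)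
    qed
    ultimately show ?thesis by blast
  qed
qed

section \<open>Weakly null perturbations and asymptotic uniform smoothness\<close>

lemma subspace_closure:
  fixes E :: "'a::real_normed_vector set"
  assumes E: "subspace E"
  shows "subspace (closure E)"
proof (rule subspaceI)
  show "0 \<in> closure E"
    using subspace_0[OF E] closure_subset by blast
  show "x + y \<in> closure E" if xy: "x \<in> closure E" "y \<in> closure E" for x y
  proof -
    obtain f g where "\<And>n. f n \<in> E" "f \<longlonglongrightarrow> x" "\<And>n. g n \<in> E" "g \<longlonglongrightarrow> y"
      using xy unfolding closure_sequential by blast
    then show ?thesis
      unfolding closure_sequential using subspace_add[OF E]
      by (intro exI[of _ "\<lambda>n. f n + g n"]) (auto intro: tendsto_add)
  qed
  show "c *\<^sub>R x \<in> closure E" if x: "x \<in> closure E" for c x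
  proof -
    obtain f where "\<And>n. f n \<in> E" "f \<longlonglongrightarrow> x"
      using x unfolding closure_sequential by blast
    then show ?thesis
      unfolding closure_sequential using subspace_scale[OF E]
      by (intro exI[of _ "\<lambda>n. c *\<^sub>R f n"]) (auto intro: tendsto_intros)
  qed
qed

text \<open>\<open>finite_codim\<close> does not ask for closedness, so one passes to the closure and back.\<close>
lemma weakly_null_close_to_finite_codim:
  fixes d :: "'i \<Rightarrow> 'b::real_normed_vector"
  assumes E: "finite_codim E"
    and d: "\<And>\<phi> :: 'b \<Rightarrow> real. bounded_linear \<phi> \<Longrightarrow> ((\<lambda>n. \<phi> (d n)) \<longlongrightarrow> 0) U"
    and "\<delta> > 0"
  shows "\<forall>\<^sub>F n in U. \<exists>e\<in>E. norm (d n - e) < \<delta>"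
proof -
  obtain F where F: "finite F" "span (E \<union> F) = UNIV" "subspace E"
    using E by (auto simp: finite_codim_def)
  have "span (closure E \<union> F) = UNIV"
    using F(2) span_mono[of "E \<union> F" "closure E \<union> F"] closure_subset[of E] by auto
  then obtain e where e: "\<And>n. e n \<in> closure E" "((\<lambda>n. d n - e n) \<longlongrightarrow> 0) U"
    using weakly_null_close_to_closed_finite_codim[OF F(1) subspace_closure[OF F(3)] closed_closure,
        where d = d and U = U] d by blast
  have "\<forall>\<^sub>F n in U. norm (d n - e n) < \<delta> / 2"
    using tendstoD[OF e(2), of "\<delta> / 2"] \<open>\<delta> > 0\<close> by (simp add: dist_norm)
  then show ?thesis
  proof (rule eventually_mono)
    fix n assume n: "norm (d n - e n) < \<delta> / 2"
    obtain e' where e': "e' \<in> E" "dist e' (e n) < \<delta> / 2"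
      using e(1)[of n] \<open>\<delta> > 0\<close> closure_approachableD[of "e n" E "\<delta> / 2"] by (auto simp: dist_commute)
    have "norm (d n - e') \<le> norm (d n - e n) + norm (e n - e')"
      using norm_triangle_ineq[of "d n - e n" "e n - e'"] by simp
    then show "\<exists>e\<in>E. norm (d n - e) < \<delta>"
      using n e' by (intro bexI[of _ e']) (auto simp: dist_norm norm_minus_commute)
  qed
qed

text \<open>The modulus controls perturbations of norm exactly \<open>t\<close> inside a suitable
  finite-codimensional \<open>E\<close>, while \<open>d n\<close> is only close to \<open>E\<close>
  and only bounded by \<open>t\<close>. The error \<open>\<epsilon>\<close> is split into
  \<open>\<epsilon> / 2\<close> for choosing \<open>E\<close>, \<open>\<epsilon> / 4\<close> for
  approximating \<open>d n\<close> in \<open>E\<close> and \<open>\<epsilon> / 4\<close> for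
  rescaling the approximant.\<close>

lemma asympt_unif_smooth_weakly_null:
  fixes d :: "'i \<Rightarrow> 'b::real_normed_vector" and x :: 'b
  assumes C: "aus_modulus TYPE('b) t \<le> ereal (C * t powr q)" and t: "0 < t"
    and d: "\<And>\<phi> :: 'b \<Rightarrow> real. bounded_linear \<phi> \<Longrightarrow> ((\<lambda>n. \<phi> (d n)) \<longlongrightarrow> 0) U"
    and x: "norm x = 1" and dt: "\<And>n. norm (d n) \<le> t" and "0 \<le> C" and "\<epsilon> > 0"
  shows "\<forall>\<^sub>F n in U. norm (x + d n) \<le> 1 + C * t powr q + \<epsilon>"
proof -
  have "(INF E\<in>{E::'b set. finite_codim E}. SUP h\<in>(sphere 0 1 \<inter> E). ereal (norm (x + t *\<^sub>R h) - 1))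
      \<le> ereal (C * t powr q)"
    using C x unfolding aus_modulus_def by (auto simp: SUP_le_iff)
  also have "\<dots> < ereal (C * t powr q + \<epsilon> / 2)" using \<open>\<epsilon> > 0\<close> by simp
  finally obtain E :: "'b set" where E: "finite_codim E"
    and lt: "(SUP h\<in>(sphere 0 1 \<inter> E). ereal (norm (x + t *\<^sub>R h) - 1)) < ereal (C * t powr q + \<epsilon> / 2)"
    by (auto simp: INF_less_iff)
  have sub: "subspace E" using E by (simp add: finite_codim_def)
  have unit: "norm (x + t *\<^sub>R h) \<le> 1 + C * t powr q + \<epsilon> / 2" if "h \<in> E" "norm h = 1" for h
  proof -
    have "ereal (norm (x + t *\<^sub>R h) - 1) \<le> (SUP h\<in>(sphere 0 1 \<inter> E). ereal (norm (x + t *\<^sub>R h) - 1))"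
      using that by (intro SUP_upper) auto
    then have "ereal (norm (x + t *\<^sub>R h) - 1) < ereal (C * t powr q + \<epsilon> / 2)"
      using lt by (rule le_less_trans)
    then show ?thesis by simp
  qed
  have small: "norm (x + h) \<le> 1 + C * t powr q + \<epsilon> / 2" if h: "h \<in> E" "norm h \<le> t" for h
  proof (cases "h = 0")
    case True
    then show ?thesis using x \<open>0 \<le> C\<close> \<open>\<epsilon> > 0\<close> by simp
  next
    case False
    define s where "s = norm h / t"
    define u where "u = h /\<^sub>R norm h"
    have s: "0 \<le> s" "s \<le> 1" using h t by (auto simp: s_def)
    have u: "u \<in> E" "norm u = 1" using False h sub by (auto simp: u_def subspace_scale)
    \<comment> \<open>A point on the segment from \<open>x\<close> to a perturbation of norm
      \<open>t\<close>: convexity of the norm extends the bound from the sphere of radius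
      \<open>t\<close> to the ball.\<close>
    have "x + h = (1 - s) *\<^sub>R x + s *\<^sub>R (x + t *\<^sub>R u)"
      using False t by (simp add: s_def u_def algebra_simps)
    then have "norm (x + h) \<le> (1 - s) * norm x + s * norm (x + t *\<^sub>R u)"
      using norm_triangle_ineq[of "(1 - s) *\<^sub>R x" "s *\<^sub>R (x + t *\<^sub>R u)"] s by simp
    also have "\<dots> \<le> (1 - s) * (1 + C * t powr q + \<epsilon> / 2) + s * (1 + C * t powr q + \<epsilon> / 2)"
      using s x unit[OF u] \<open>0 \<le> C\<close> \<open>\<epsilon> > 0\<close> by (intro add_mono mult_left_mono) auto
    also have "\<dots> = 1 + C * t powr q + \<epsilon> / 2"
      unfolding distrib_right[symmetric] by simp
    finally show ?thesis .
  qed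
  have "\<forall>\<^sub>F n in U. \<exists>e\<in>E. norm (d n - e) < \<epsilon> / 4"
    by (rule weakly_null_close_to_finite_codim[OF E]) (use d \<open>\<epsilon> > 0\<close> in auto)
  then show ?thesis
  proof (rule eventually_mono)
    fix n assume "\<exists>e\<in>E. norm (d n - e) < \<epsilon> / 4"
    then obtain e where e: "e \<in> E" "norm (d n - e) < \<epsilon> / 4" by blast
    \<comment> \<open>The approximant may have norm up to \<open>t + \<epsilon> / 4\<close>; this
      factor brings it back into the ball of radius \<open>t\<close> and moves it by at most
      \<open>\<epsilon> / 4\<close>.\<close>
    define e' where "e' = (t / (t + \<epsilon> / 4)) *\<^sub>R e"
    have ne: "norm e \<le> t + \<epsilon> / 4"
      using norm_triangle_ineq2[of e "d n"] dt[of n] e(2) by (simp add: norm_minus_commute)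
    have "norm e' = t * (norm e / (t + \<epsilon> / 4))"
      using t \<open>\<epsilon> > 0\<close> by (simp add: e'_def)
    also have "\<dots> \<le> t * 1"
      using ne t \<open>\<epsilon> > 0\<close> by (intro mult_left_mono) (auto simp: divide_le_eq)
    finally have "norm e' \<le> t" by simp
    moreover have "e' \<in> E" using e(1) sub by (simp add: e'_def subspace_scale)
    ultimately have "norm (x + e') \<le> 1 + C * t powr q + \<epsilon> / 2" by (intro small)
    moreover have "norm (e - e') \<le> \<epsilon> / 4"
    proof -
      have "e - e' = ((\<epsilon> / 4) / (t + \<epsilon> / 4)) *\<^sub>R e"
      proof -
        have "1 - t / (t + \<epsilon> / 4) = (\<epsilon> / 4) / (t + \<epsilon> / 4)"
          using t \<open>\<epsilon> > 0\<close> by (simp add: field_simps)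
        then show ?thesis
          unfolding e'_def by (metis scaleR_left_diff_distrib scaleR_one)
      qed
      then have "norm (e - e') = (\<epsilon> / 4) * (norm e / (t + \<epsilon> / 4))"
        using t \<open>\<epsilon> > 0\<close> by simp
      also have "\<dots> \<le> (\<epsilon> / 4) * 1"
        using ne t \<open>\<epsilon> > 0\<close> by (intro mult_left_mono) (auto simp: divide_le_eq)
      finally show ?thesis by simp
    qed
    moreover have "norm (x + d n) \<le> norm (x + e') + norm (e - e') + norm (d n - e)"
      using norm_triangle_ineq[of "x + e'" "e - e'"] norm_triangle_ineq[of "x + e" "d n - e"] by simp
    ultimately show "norm (x + d n) \<le> 1 + C * t powr q + \<epsilon>"
      using e(2) by linarith
  qed
qed

text \<open>Convexity of the power function on the segment from 1 to \<open>1 + D\<close>. It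
  converts an estimate of norms into an additive estimate of their powers.\<close>

lemma powr_one_plus_le:
  fixes u D q :: real
  assumes "0 \<le> u" "u \<le> 1" "0 \<le> D" "1 \<le> q"
  shows "(1 + D * u) powr q \<le> 1 + (1 + D) powr q * u"
proof -
  have conv: "convex_on {0<..} (\<lambda>x::real. x powr q)"
    using assms(4) by (rule powr_convex)
  have "((1 - u) *\<^sub>R 1 + u *\<^sub>R (1 + D)) powr q \<le> (1 - u) * 1 powr q + u * (1 + D) powr q"
    using assms by (intro convex_onD[OF conv]) auto
  also have "(1 - u) *\<^sub>R 1 + u *\<^sub>R (1 + D) = 1 + D * u" by (simp add: algebra_simps)
  finally show ?thesis using assms(1) by (simp add: algebra_simps)
qed

text \<open>For \<open>norm x \<ge> L\<close> apply the modulus at \<open>t = L / norm x\<close> with error \<open>\<epsilon> = C * t powr q\<close>;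
  for smaller \<open>x\<close> the triangle inequality suffices as \<open>K \<ge> 2\<close>.\<close>
lemma asympt_unif_smooth_powr:
  fixes d :: "'i \<Rightarrow> 'b::real_normed_vector" and x :: 'b
  assumes q: "1 < q" and C: "0 < C" "\<And>t. t \<in> {0..1} \<Longrightarrow> aus_modulus TYPE('b) t \<le> ereal (C * t powr q)"
    and d: "\<And>\<phi> :: 'b \<Rightarrow> real. bounded_linear \<phi> \<Longrightarrow> ((\<lambda>n. \<phi> (d n)) \<longlongrightarrow> 0) U"
    and L: "0 < L" "\<And>n. norm (d n) \<le> L"
  shows "\<forall>\<^sub>F n in U. norm (x + d n) powr q \<le> norm x powr q + ((2 + 2 * C) * L) powr q"
proof (cases "norm x < L")
  case True
  have "norm (x + d n) powr q \<le> norm x powr q + ((2 + 2 * C) * L) powr q" for n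
  proof -
    have "norm (x + d n) \<le> 2 * L"
      using norm_triangle_ineq[of x "d n"] True L(2)[of n] by simp
    also have "\<dots> \<le> (2 + 2 * C) * L" using C(1) L(1) by simp
    finally have "norm (x + d n) powr q \<le> ((2 + 2 * C) * L) powr q"
      using q by (intro powr_mono2) auto
    then show ?thesis by (simp add: add_increasing)
  qed
  then show ?thesis by simp
next
  case False
  define s where "s = norm x"
  define t where "t = L / s"
  have s: "s > 0" "L \<le> s" using False L by (auto simp: s_def)
  have t: "0 < t" "t \<le> 1" using s L by (auto simp: t_def)
  have tq: "0 < t powr q" "t powr q \<le> 1"
    using t q powr_mono2[of q t 1] by auto
  have "\<forall>\<^sub>F n in U. norm (x /\<^sub>R s + d n /\<^sub>R s) \<le> 1 + C * t powr q + C * t powr q"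
  proof (rule asympt_unif_smooth_weakly_null)
    show "aus_modulus TYPE('b) t \<le> ereal (C * t powr q)" using C(2) t by simp
    show "((\<lambda>n. \<phi> (d n /\<^sub>R s)) \<longlongrightarrow> 0) U" if "bounded_linear \<phi>" for \<phi> :: "'b \<Rightarrow> real"
    proof -
      interpret \<phi>: bounded_linear \<phi> by (rule that)
      show ?thesis using tendsto_scaleR[OF tendsto_const[of "inverse s"] d[OF that]]
        by (simp add: \<phi>.scaleR)
    qed
    show "norm (d n /\<^sub>R s) \<le> t" for n
      using L(2)[of n] s by (simp add: t_def field_simps)
  qed (use s t tq C in \<open>auto simp: s_def\<close>)
  then show ?thesis
  proof (rule eventually_mono)
    fix n assume n: "norm (x /\<^sub>R s + d n /\<^sub>R s) \<le> 1 + C * t powr q + C * t powr q"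
    have "norm (x + d n) = s * norm (x /\<^sub>R s + d n /\<^sub>R s)"
      using s by (simp add: scaleR_add_right[symmetric])
    also have "\<dots> \<le> s * (1 + (2 * C) * t powr q)"
      using n s by (intro mult_left_mono) auto
    finally have "norm (x + d n) powr q \<le> (s * (1 + (2 * C) * t powr q)) powr q"
      using q by (intro powr_mono2) auto
    also have "\<dots> = s powr q * (1 + (2 * C) * t powr q) powr q"
      using s C tq by (intro powr_mult)
    also have "\<dots> \<le> s powr q * (1 + (1 + 2 * C) powr q * t powr q)"
      using tq C q by (intro mult_left_mono powr_one_plus_le) auto
    \<comment> \<open>Since \<open>s * t = L\<close>, the added term no longer depends on
      \<open>x\<close>; this is what allows increments to be summed over the coordinates.\<close>
    also have "\<dots> = s powr q + (1 + 2 * C) powr q * (s * t) powr q"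
      using s t by (simp add: powr_mult algebra_simps)
    also have "s * t = L" using s by (simp add: t_def)
    also have "(1 + 2 * C) powr q * L powr q \<le> (2 + 2 * C) powr q * L powr q"
      using C q by (intro mult_right_mono powr_mono2) auto
    also have "\<dots> = ((2 + 2 * C) * L) powr q"
      using C L by (simp add: powr_mult)
    finally show "norm (x + d n) powr q \<le> norm x powr q + ((2 + 2 * C) * L) powr q"
      by (simp add: s_def)
  qed
qed

section \<open>Concentration of Lipschitz maps on tuples\<close>

text \<open>This is largeness for the \<open>k\<close>-fold Fubini power of \<open>U\<close>. The
  quantifier of the last coordinate is innermost, so the large set from which it is chosen may
  depend on all earlier coordinates.\<close>

primrec iter_eventually :: "nat filter \<Rightarrow> nat \<Rightarrow> (nat list \<Rightarrow> bool) \<Rightarrow> bool" where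
  "iter_eventually U 0 P = P []"
| "iter_eventually U (Suc k) P = iter_eventually U k (\<lambda>ns. \<forall>\<^sub>F n in U. P (ns @ [n]))"

lemma iter_eventually_mono:
  assumes "iter_eventually U k P" "\<And>ns. length ns = k \<Longrightarrow> P ns \<Longrightarrow> Q ns"
  shows "iter_eventually U k Q"
  using assms
proof (induction k arbitrary: P Q)
  case (Suc k)
  have "iter_eventually U k (\<lambda>ns. \<forall>\<^sub>F n in U. Q (ns @ [n]))"
  proof (rule Suc.IH)
    show "iter_eventually U k (\<lambda>ns. \<forall>\<^sub>F n in U. P (ns @ [n]))" using Suc.prems(1) by simp
    show "\<forall>\<^sub>F n in U. Q (ns @ [n])" if "length ns = k" "\<forall>\<^sub>F n in U. P (ns @ [n])" for ns
      using that(2) by (rule eventually_mono) (use that(1) Suc.prems(2) in auto)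
  qed
  then show ?case by simp
qed simp

lemma iter_eventually_conj:
  assumes "iter_eventually U k P" "iter_eventually U k Q"
  shows "iter_eventually U k (\<lambda>ns. P ns \<and> Q ns)"
  using assms by (induction k arbitrary: P Q) (auto simp: eventually_conj_iff)

lemma iter_eventually_ex:
  assumes "iter_eventually U k P" "U \<noteq> bot"
  shows "\<exists>ns. length ns = k \<and> P ns"
  using assms(1)
proof (induction k arbitrary: P)
  case (Suc k)
  then obtain ns where "length ns = k" "\<forall>\<^sub>F n in U. P (ns @ [n])" by auto
  then show ?case using eventually_happens'[OF assms(2)] by (metis length_append_singleton)
qed simp

text \<open>Serves properties that can be secured one coordinate at a time, such as distinctness or
  smallness under a fixed functional.\<close>

lemma iter_eventually_extend:
  assumes "P []" "\<And>ns. P ns \<Longrightarrow> \<forall>\<^sub>F n in U. P (ns @ [n])"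
  shows "iter_eventually U k P"
proof (induction k)
  case (Suc k)
  have "iter_eventually U k (\<lambda>ns. \<forall>\<^sub>F n in U. P (ns @ [n]))"
    using Suc by (rule iter_eventually_mono) (rule assms(2))
  then show ?case by simp
qed (simp add: assms(1))

text \<open>Replacing the last coordinate by its weak limit keeps the map Lipschitz in every remaining
  coordinate, and the differences are weakly null along \<open>U\<close>, so each coordinate
  contributes one application of asymptotic smoothness.\<close>
lemma Hamming_Lipschitz_concentration:
  fixes G :: "nat list \<Rightarrow> 'b::real_normed_vector"
  assumes refl: "reflexive_space TYPE('b)" and U: "free_ultrafilter U"
    and q: "1 < q" and C: "0 < C" "\<And>t. t \<in> {0..1} \<Longrightarrow> aus_modulus TYPE('b) t \<le> ereal (C * t powr q)"
    and L: "0 < L"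
    and Lip: "\<And>as bs a b. Suc (length as + length bs) = k \<Longrightarrow> norm (G (as @ a # bs) - G (as @ b # bs)) \<le> L"
  shows "\<exists>y. iter_eventually U k (\<lambda>ns. norm (G ns - y) powr q \<le> real k * ((2 + 2 * C) * L) powr q)"
  using Lip
proof (induction k arbitrary: G)
  case 0
  show ?case by (intro exI[of _ "G []"]) simp
next
  case (Suc k)
  have nb: "U \<noteq> bot" using U by (simp add: free_ultrafilter_def)
  have last: "norm (G (ns @ [m]) - G (ns @ [n])) \<le> L" if "length ns = k" for ns m n
    using Suc.prems[of ns "[]" m n] that by simp
  have "\<exists>y. \<forall>\<phi> :: 'b \<Rightarrow> real. bounded_linear \<phi> \<longrightarrow> ((\<lambda>n. \<phi> (G (ns @ [n]))) \<longlongrightarrow> \<phi> y) U"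
    if ns: "length ns = k" for ns
  proof (rule reflexive_weak_limit[OF refl U])
    show "norm (G (ns @ [n])) \<le> norm (G (ns @ [0])) + L" for n
      using last[OF ns, of n 0] norm_triangle_ineq2[of "G (ns @ [n])" "G (ns @ [0])"] by linarith
  qed
  then obtain H where H: "\<And>ns \<phi>. length ns = k \<Longrightarrow> bounded_linear \<phi> \<Longrightarrow>
      ((\<lambda>n. \<phi> (G (ns @ [n]))) \<longlongrightarrow> (\<phi> (H ns) :: real)) U"
    by metis
  have "\<exists>y. iter_eventually U k (\<lambda>ns. norm (H ns - y) powr q \<le> real k * ((2 + 2 * C) * L) powr q)"
  proof (rule Suc.IH)
    fix as bs :: "nat list" and a b
    assume len: "Suc (length as + length bs) = k"
    show "norm (H (as @ a # bs) - H (as @ b # bs)) \<le> L"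
    proof (rule norm_weak_limit_le[OF _ nb])
      fix \<phi> :: "'b \<Rightarrow> real" assume "bounded_linear \<phi>"
      then interpret \<phi>: bounded_linear \<phi> .
      show "((\<lambda>n. \<phi> (G ((as @ a # bs) @ [n]) - G ((as @ b # bs) @ [n]))) \<longlongrightarrow>
          \<phi> (H (as @ a # bs) - H (as @ b # bs))) U"
        unfolding \<phi>.diff by (intro tendsto_diff H \<phi>.bounded_linear_axioms) (use len in auto)
    next
      show "norm (G ((as @ a # bs) @ [n]) - G ((as @ b # bs) @ [n])) \<le> L" for n
        using Suc.prems[of as "bs @ [n]" a b] len by simp
    qed
  qed
  then obtain y where y: "iter_eventually U k
      (\<lambda>ns. norm (H ns - y) powr q \<le> real k * ((2 + 2 * C) * L) powr q)" by blast
  have "iter_eventually U k (\<lambda>ns. \<forall>\<^sub>F n in U. norm (G (ns @ [n]) - y) powr q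
      \<le> real (Suc k) * ((2 + 2 * C) * L) powr q)"
    using y
  proof (rule iter_eventually_mono)
    fix ns :: "nat list"
    assume ns: "length ns = k" and bd: "norm (H ns - y) powr q \<le> real k * ((2 + 2 * C) * L) powr q"
    have "\<forall>\<^sub>F n in U. norm ((H ns - y) + (G (ns @ [n]) - H ns)) powr q
        \<le> norm (H ns - y) powr q + ((2 + 2 * C) * L) powr q"
    proof (rule asympt_unif_smooth_powr[OF q C])
      show "((\<lambda>n. \<phi> (G (ns @ [n]) - H ns)) \<longlongrightarrow> 0) U" if "bounded_linear \<phi>" for \<phi> :: "'b \<Rightarrow> real"
      proof -
        interpret \<phi>: bounded_linear \<phi> by (rule that)
        show ?thesis
          using tendsto_diff[OF H[OF ns that] tendsto_const[of "\<phi> (H ns)"]] by (simp add: \<phi>.diff)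
      qed
      show "norm (G (ns @ [n]) - H ns) \<le> L" for n
      proof -
        \<comment> \<open>With \<open>n\<close> fixed, the weak limit is taken in the other index
          \<open>m\<close>; all these differences are bounded by \<open>L\<close>.\<close>
        have "norm (H ns - G (ns @ [n])) \<le> L"
        proof (rule norm_weak_limit_le[OF _ nb])
          fix \<phi> :: "'b \<Rightarrow> real" assume "bounded_linear \<phi>"
          then interpret \<phi>: bounded_linear \<phi> .
          show "((\<lambda>m. \<phi> (G (ns @ [m]) - G (ns @ [n]))) \<longlongrightarrow> \<phi> (H ns - G (ns @ [n]))) U"
            unfolding \<phi>.diff by (intro tendsto_diff H[OF ns] \<phi>.bounded_linear_axioms tendsto_const)
        next
          show "norm (G (ns @ [m]) - G (ns @ [n])) \<le> L" for m by (rule last[OF ns])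
        qed
        then show ?thesis by (simp add: norm_minus_commute)
      qed
    qed (use L in auto)
    then show "\<forall>\<^sub>F n in U. norm (G (ns @ [n]) - y) powr q \<le> real (Suc k) * ((2 + 2 * C) * L) powr q"
      by (rule eventually_mono) (use bd in \<open>simp add: algebra_simps\<close>)
  qed
  then show ?case by auto
qed

section \<open>The Ramsey theorem of Galvin and Nash-Williams\<close>

text \<open>Here \<open>s\<close> followed by the part of \<open>N\<close> beyond \<open>s\<close>
  is cut at \<open>n\<close>, so the condition asks for an initial segment in the family. Together
  with \<open>rejects\<close> this is the usual combinatorial forcing.\<close>

definition accepts :: "nat set set \<Rightarrow> nat set \<Rightarrow> nat set \<Rightarrow> bool" where
  "accepts \<F> s M \<longleftrightarrow> (\<forall>N. infinite N \<and> N \<subseteq> M \<longrightarrow>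
     (\<exists>n. (s \<union> {m \<in> N. \<forall>i\<in>s. i < m}) \<inter> {..<n} \<in> \<F>))"

definition rejects :: "nat set set \<Rightarrow> nat set \<Rightarrow> nat set \<Rightarrow> bool" where
  "rejects \<F> s M \<longleftrightarrow> (\<forall>N. infinite N \<and> N \<subseteq> M \<longrightarrow> \<not> accepts \<F> s N)"

lemma infinite_above:
  fixes N :: "nat set"
  assumes "finite s" "infinite N"
  shows "infinite {m \<in> N. \<forall>i\<in>s. i < m}"
proof
  assume "finite {m \<in> N. \<forall>i\<in>s. i < m}"
  moreover have "N \<subseteq> {m \<in> N. \<forall>i\<in>s. i < m} \<union> (\<Union>i\<in>s. {..i})"
    by (auto simp: not_less)
  moreover have "finite (\<Union>i\<in>s. {..i})" using assms(1) by simp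
  ultimately show False using assms(2) finite_subset by blast
qed

text \<open>Only the elements beyond \<open>s\<close> matter, so acceptance passes to any set
  contained in \<open>M\<close> past \<open>s\<close>. This tolerance is what makes diagonal sets
  usable.\<close>

lemma accepts_transfer:
  assumes M: "accepts \<F> s M" and s: "finite s" and N: "{m \<in> N. \<forall>i\<in>s. i < m} \<subseteq> M"
  shows "accepts \<F> s N"
  unfolding accepts_def
proof (intro allI impI)
  fix N' assume N': "infinite N' \<and> N' \<subseteq> N"
  let ?A = "{m \<in> N'. \<forall>i\<in>s. i < m}"
  have "infinite ?A" "?A \<subseteq> M"
    using N' N infinite_above[OF s] by auto
  then obtain n where "(s \<union> {m \<in> ?A. \<forall>i\<in>s. i < m}) \<inter> {..<n} \<in> \<F>"
    using M unfolding accepts_def by blast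
  moreover have "{m \<in> ?A. \<forall>i\<in>s. i < m} = ?A" by auto
  ultimately show "\<exists>n. (s \<union> ?A) \<inter> {..<n} \<in> \<F>" by metis
qed

lemma rejects_transfer:
  assumes M: "rejects \<F> s M" and s: "finite s" and N: "{m \<in> N. \<forall>i\<in>s. i < m} \<subseteq> M"
  shows "rejects \<F> s N"
  unfolding rejects_def
proof (intro allI impI notI)
  fix N' assume N': "infinite N' \<and> N' \<subseteq> N" and acc: "accepts \<F> s N'"
  let ?A = "{m \<in> N'. \<forall>i\<in>s. i < m}"
  have "infinite ?A" "?A \<subseteq> M"
    using N' N infinite_above[OF s] by auto
  moreover have "accepts \<F> s ?A"
    using acc s by (rule accepts_transfer) auto
  ultimately show False using M unfolding rejects_def by blast
qed

text \<open>If a set is not rejected, some infinite subset accepts it; both outcomes persist on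
  infinite subsets, so finitely many sets can be treated in turn.\<close>

lemma decide_finite:
  assumes "finite S" "\<And>s. s \<in> S \<Longrightarrow> finite s" "infinite M"
  shows "\<exists>N\<subseteq>M. infinite N \<and> (\<forall>s\<in>S. accepts \<F> s N \<or> rejects \<F> s N)"
  using assms
proof (induction S)
  case (insert s S)
  then obtain N where N: "N \<subseteq> M" "infinite N" "\<And>s. s \<in> S \<Longrightarrow> accepts \<F> s N \<or> rejects \<F> s N"
    by auto
  obtain N' where N': "N' \<subseteq> N" "infinite N'" "accepts \<F> s N' \<or> rejects \<F> s N'"
    using N(2) unfolding rejects_def by blast
  have "accepts \<F> t N' \<or> rejects \<F> t N'" if "t \<in> S" for t
    using N(3)[OF that] accepts_transfer[of \<F> t N N'] rejects_transfer[of \<F> t N N']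
      insert.prems(1)[of t] that N'(1) by blast
  then show ?case using N N' by (intro exI[of _ N']) auto
qed auto

text \<open>In \<open>R F M\<close> the set \<open>F\<close> holds the elements picked so far and
  \<open>M\<close> is the reservoir for later picks. The result is the set of all picks: each finite
  part of it lies in some stage whose reservoir contains everything picked beyond that part.\<close>

lemma fusion:
  fixes R :: "nat set \<Rightarrow> nat set \<Rightarrow> bool"
  assumes R0: "R {} M0" and inf: "infinite M0"
    and step: "\<And>F M. finite F \<Longrightarrow> infinite M \<Longrightarrow> M \<subseteq> M0 \<Longrightarrow> R F M \<Longrightarrow>
      \<exists>n\<in>M. \<exists>N\<subseteq>M. infinite N \<and> (\<forall>m\<in>N. n < m) \<and> R (insert n F) N"
  shows "\<exists>A\<subseteq>M0. infinite A \<and> (\<forall>s\<subseteq>A. finite s \<longrightarrow>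
      (\<exists>F M. s \<subseteq> F \<and> R F M \<and> {m \<in> A. \<forall>i\<in>s. i < m} \<subseteq> M))"
proof -
  define ok where "ok k x \<longleftrightarrow> finite (fst x) \<and> infinite (snd x) \<and> snd x \<subseteq> M0 \<and> R (fst x) (snd x) \<and>
      (k = 0 \<longrightarrow> fst x = {})" for k :: nat and x
  define nxt where "nxt x y \<longleftrightarrow> (\<exists>n\<in>snd x. fst y = insert n (fst x) \<and> snd y \<subseteq> snd x \<and>
      (\<forall>m\<in>snd y. n < m))" for x y :: "nat set \<times> nat set"
  have "\<exists>f. \<forall>k. ok k (f k) \<and> nxt (f k) (f (Suc k))"
  proof (rule dependent_nat_choice)
    show "\<exists>x. ok 0 x"
      using R0 inf by (intro exI[of _ "({}, M0)"]) (auto simp: ok_def)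
  next
    fix x k
    assume x: "ok k x"
    then obtain n N where "n \<in> snd x" "N \<subseteq> snd x" "infinite N" "\<forall>m\<in>N. n < m" "R (insert n (fst x)) N"
      using step[of "fst x" "snd x"] unfolding ok_def by blast
    then show "\<exists>y. ok (Suc k) y \<and> nxt x y"
      using x by (intro exI[of _ "(insert n (fst x), N)"]) (auto simp: ok_def nxt_def)
  qed
  then obtain f where ok: "\<And>k. ok k (f k)" and nxt: "\<And>k. nxt (f k) (f (Suc k))" by blast
  have f: "\<And>k. snd (f k) \<subseteq> M0" "\<And>k. R (fst (f k)) (snd (f k))" "fst (f 0) = {}"
    using ok by (auto simp: ok_def)
  obtain g where g: "\<And>k. g k \<in> snd (f k)" "\<And>k. fst (f (Suc k)) = insert (g k) (fst (f k))"
    "\<And>k. snd (f (Suc k)) \<subseteq> snd (f k)" "\<And>k m. m \<in> snd (f (Suc k)) \<Longrightarrow> g k < m"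
    using nxt unfolding nxt_def Bex_def by metis
  have F: "fst (f k) = g ` {..<k}" for k
    by (induction k) (auto simp: f(3) g(2) lessThan_Suc)
  have anti: "snd (f l) \<subseteq> snd (f k)" if "k \<le> l" for k l
    using that g(3) by (rule lift_Suc_antimono_le[rotated])
  have mono: "strict_mono g"
    unfolding strict_mono_Suc_iff using g(1,4) by blast
  show ?thesis
  proof (rule exI[of _ "range g"], intro conjI allI impI)
    show "range g \<subseteq> M0" using g(1) f(1) by blast
    show "infinite (range g)" using mono by (simp add: range_inj_infinite strict_mono_imp_inj_on)
    fix s assume s: "s \<subseteq> range g" "finite s"
    obtain K where "finite K" "s = g ` K" using s by (meson finite_subset_image)
    then have "\<exists>i. s \<subseteq> g ` {..<i}"
      using finite_nat_set_iff_bounded[of K] by blast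
    \<comment> \<open>Minimality of the stage matters: a pick exceeding all of \<open>s\<close> has
      index at least \<open>i\<close>, hence comes from the reservoir of stage
      \<open>i\<close>.\<close>
    define i where "i = (LEAST i. s \<subseteq> g ` {..<i})"
    have i: "s \<subseteq> g ` {..<i}"
      unfolding i_def by (rule LeastI_ex) fact
    have "{m \<in> range g. \<forall>i\<in>s. i < m} \<subseteq> snd (f i)"
    proof clarify
      fix j assume j: "\<forall>i\<in>s. i < g j"
      have "s \<subseteq> g ` {..<j}"
      proof
        fix x assume "x \<in> s"
        then obtain l where "x = g l" "g l < g j" using s(1) j by blast
        then show "x \<in> g ` {..<j}" using mono by (simp add: strict_mono_less)
      qed
      then have "i \<le> j" unfolding i_def by (rule Least_le)
      then show "g j \<in> snd (f i)" using anti g(1) by blast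
    qed
    then show "\<exists>F M. s \<subseteq> F \<and> R F M \<and> {m \<in> range g. \<forall>i\<in>s. i < m} \<subseteq> M"
      using i f(2)[of i] F[of i] by blast
  qed
qed

text \<open>Take the least element \<open>n\<close> of an infinite subset of \<open>N\<close>:
  following \<open>s\<close> by that subset is the same as following \<open>insert n s\<close> by
  the rest of it.\<close>

lemma accepts_of_extensions:
  assumes N: "\<And>n. n \<in> N \<Longrightarrow> (\<forall>i\<in>s. i < n) \<and> accepts \<F> (insert n s) A" and NA: "N \<subseteq> A"
  shows "accepts \<F> s N"
  unfolding accepts_def
proof (intro allI impI)
  fix N' assume N': "infinite N' \<and> N' \<subseteq> N"
  define n where "n = (LEAST n. n \<in> N')"
  have ne: "\<exists>n. n \<in> N'" using N' infinite_imp_nonempty by blast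
  have n: "n \<in> N'" unfolding n_def using ne by (rule LeastI_ex)
  have least: "n \<le> m" if "m \<in> N'" for m unfolding n_def using that by (rule Least_le)
  have "accepts \<F> (insert n s) A" using N N' n by blast
  then have "\<exists>l. (insert n s \<union> {m \<in> N'. \<forall>i\<in>insert n s. i < m}) \<inter> {..<l} \<in> \<F>"
    using N' NA unfolding accepts_def by blast
  moreover have "insert n s \<union> {m \<in> N'. \<forall>i\<in>insert n s. i < m} = s \<union> {m \<in> N'. \<forall>i\<in>s. i < m}"
  proof -
    have "n < m" if "m \<in> N'" "m \<noteq> n" for m using least[OF that(1)] that(2) by simp
    then show ?thesis using N N' n by auto
  qed
  ultimately show "\<exists>l. (s \<union> {m \<in> N'. \<forall>i\<in>s. i < m}) \<inter> {..<l} \<in> \<F>" by simp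
qed

text \<open>If no infinite set accepts the empty set, all reject it. A first fusion yields
  \<open>A\<close> that accepts or rejects each of its finite subsets, a second yields
  \<open>B\<close> inside \<open>A\<close> whose finite subsets are all rejected. Members of the
  family cannot be rejected, so none of them lies in \<open>B\<close>.\<close>

theorem Galvin_Nash_Williams:
  fixes \<F> :: "nat set set"
  obtains M where "infinite M" "\<And>s. finite s \<Longrightarrow> s \<subseteq> M \<Longrightarrow> s \<notin> \<F>"
  | M where "infinite M" "\<And>N. infinite N \<Longrightarrow> N \<subseteq> M \<Longrightarrow> \<exists>n. N \<inter> {..<n} \<in> \<F>"
proof (cases "\<exists>M. infinite M \<and> accepts \<F> {} M")
  case True
  then show thesis using that(2) unfolding accepts_def by auto
next
  case False
  then have rej0: "rejects \<F> {} M" for M by (auto simp: rejects_def)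
  have "\<exists>A\<subseteq>UNIV. infinite A \<and> (\<forall>s\<subseteq>A. finite s \<longrightarrow> (\<exists>F M. s \<subseteq> F \<and>
      (\<forall>s\<subseteq>F. accepts \<F> s M \<or> rejects \<F> s M) \<and> {m \<in> A. \<forall>i\<in>s. i < m} \<subseteq> M))"
  proof (rule fusion)
    fix F M :: "nat set" assume "finite F" "infinite M"
    then obtain n where n: "n \<in> M" using infinite_imp_nonempty by blast
    have "infinite {m \<in> M. \<forall>i\<in>{n}. i < m}"
      using \<open>infinite M\<close> by (intro infinite_above) auto
    then obtain N where "N \<subseteq> {m \<in> M. \<forall>i\<in>{n}. i < m}" "infinite N"
      "\<forall>s\<in>Pow (insert n F). accepts \<F> s N \<or> rejects \<F> s N"
      using decide_finite[of "Pow (insert n F)"] \<open>finite F\<close>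
      by (metis (no_types, lifting) PowD finite.insertI finite_Pow_iff finite_subset)
    then show "\<exists>n\<in>M. \<exists>N\<subseteq>M. infinite N \<and> (\<forall>m\<in>N. n < m) \<and>
        (\<forall>s\<subseteq>insert n F. accepts \<F> s N \<or> rejects \<F> s N)"
      using n by (intro bexI[of _ n] exI[of _ N]) auto
  qed (auto simp: rej0)
  then obtain A where A: "infinite A" and fus: "\<forall>s\<subseteq>A. finite s \<longrightarrow> (\<exists>F M. s \<subseteq> F \<and>
      (\<forall>s\<subseteq>F. accepts \<F> s M \<or> rejects \<F> s M) \<and> {m \<in> A. \<forall>i\<in>s. i < m} \<subseteq> M)"
    by (elim exE conjE)
  have dec: "accepts \<F> s A \<or> rejects \<F> s A" if s: "s \<subseteq> A" "finite s" for s
  proof -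
    obtain F M where F: "s \<subseteq> F" "\<forall>s\<subseteq>F. accepts \<F> s M \<or> rejects \<F> s M"
      and M: "{m \<in> A. \<forall>i\<in>s. i < m} \<subseteq> M"
      using fus[rule_format, OF s] by (elim exE conjE)
    show ?thesis
      using F accepts_transfer[OF _ s(2) M] rejects_transfer[OF _ s(2) M] by blast
  qed
  \<comment> \<open>Infinitely many accepted one-point extensions would together form an infinite
    subset of \<open>A\<close> accepting \<open>s\<close>.\<close>
  have few: "finite {n \<in> A. (\<forall>i\<in>s. i < n) \<and> accepts \<F> (insert n s) A}" if "rejects \<F> s A" for s
  proof (rule ccontr)
    let ?N = "{n \<in> A. (\<forall>i\<in>s. i < n) \<and> accepts \<F> (insert n s) A}"
    assume "infinite ?N"
    moreover have "accepts \<F> s ?N" by (rule accepts_of_extensions[of _ _ _ A]) auto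
    ultimately show False using that unfolding rejects_def by blast
  qed
  have "\<exists>B\<subseteq>A. infinite B \<and> (\<forall>s\<subseteq>B. finite s \<longrightarrow> (\<exists>F M. s \<subseteq> F \<and>
      (F \<subseteq> A \<and> (\<forall>s\<subseteq>F. rejects \<F> s A)) \<and> {m \<in> B. \<forall>i\<in>s. i < m} \<subseteq> M))"
  proof (rule fusion)
    fix F M :: "nat set"
    assume F: "finite F" and M: "infinite M" "M \<subseteq> A" and R: "F \<subseteq> A \<and> (\<forall>s\<subseteq>F. rejects \<F> s A)"
    \<comment> \<open>A finite set to be avoided, so that adding \<open>n\<close> to any subset of
      \<open>F\<close> preserves rejection.\<close>
    define bad where "bad = (\<Union>s\<in>Pow F. {n \<in> A. (\<forall>i\<in>s. i < n) \<and> accepts \<F> (insert n s) A})"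
    have "finite bad" unfolding bad_def using F R few by auto
    then have "infinite ({m \<in> M. \<forall>i\<in>F. i < m} - bad)"
      using infinite_above[OF F M(1)] by (rule Diff_infinite_finite)
    then have "{m \<in> M. \<forall>i\<in>F. i < m} - bad \<noteq> {}"
      by (rule infinite_imp_nonempty)
    then obtain n where n: "n \<in> M" "\<forall>i\<in>F. i < n" "n \<notin> bad"
      by auto
    have "rejects \<F> s A" if s: "s \<subseteq> insert n F" for s
    proof (cases "n \<in> s")
      case True
      define s' where "s' = s - {n}"
      have s': "s' \<subseteq> F" "s = insert n s'" using s True by (auto simp: s'_def)
      have "\<not> accepts \<F> s A" using n s' M(2) unfolding bad_def by blast
      then show ?thesis using dec[of s] s F R n(1) M(2) finite_subset[OF s] by blast
    next
      case False
      then show ?thesis using s R by blast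
    qed
    moreover have "infinite {m \<in> M. \<forall>i\<in>{n}. i < m}"
      using M(1) by (intro infinite_above) auto
    ultimately show "\<exists>n\<in>M. \<exists>N\<subseteq>M. infinite N \<and> (\<forall>m\<in>N. n < m) \<and>
        (insert n F \<subseteq> A \<and> (\<forall>s\<subseteq>insert n F. rejects \<F> s A))"
      using n(1) M(2) R by (intro bexI[of _ n] exI[of _ "{m \<in> M. \<forall>i\<in>{n}. i < m}"]) auto
  qed (auto simp: rej0 A)
  then obtain B where B: "infinite B" and fus': "\<forall>s\<subseteq>B. finite s \<longrightarrow> (\<exists>F M. s \<subseteq> F \<and>
      (F \<subseteq> A \<and> (\<forall>s\<subseteq>F. rejects \<F> s A)) \<and> {m \<in> B. \<forall>i\<in>s. i < m} \<subseteq> M)"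
    by (elim exE conjE)
  have rej: "rejects \<F> s A" if s: "s \<subseteq> B" "finite s" for s
  proof -
    obtain F where "s \<subseteq> F" "\<forall>s\<subseteq>F. rejects \<F> s A"
      using fus'[rule_format, OF s] by (elim exE conjE)
    then show ?thesis by simp
  qed
  show thesis
  proof (rule that(1)[OF B])
    fix s assume s: "finite s" "s \<subseteq> B"
    show "s \<notin> \<F>"
    proof
      assume "s \<in> \<F>"
      \<comment> \<open>A member of the family is its own initial segment, cut just after its
        maximum (at 0 if empty), so every set accepts it.\<close>
      have "\<exists>n. (s \<union> {m \<in> N. \<forall>i\<in>s. i < m}) \<inter> {..<n} \<in> \<F>" for N
      proof (cases "s = {}")
        case True
        then show ?thesis using \<open>s \<in> \<F>\<close> by (intro exI[of _ 0]) simp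
      next
        case False
        have "(s \<union> {m \<in> N. \<forall>i\<in>s. i < m}) \<inter> {..<Suc (Max s)} = s"
        proof -
          have "m \<le> Max s" if "m \<in> s" for m using s(1) that by simp
          moreover have "\<not> m \<le> Max s" if "\<forall>i\<in>s. i < m" for m
            using that Max_in[OF s(1) False] by (simp add: not_le)
          ultimately show ?thesis by (auto simp: less_Suc_eq_le)
        qed
        then show ?thesis using \<open>s \<in> \<F>\<close> by (intro exI[of _ "Suc (Max s)"]) (simp only:)
      qed
      then have "accepts \<F> s A" by (simp add: accepts_def)
      then show False using rej[OF s(2,1)] A unfolding rejects_def by blast
    qed
  qed
qed

section \<open>Rosenthal's theorem\<close>

abbreviation dual_ball :: "('a::real_normed_vector \<Rightarrow> real) set" where
  "dual_ball \<equiv> {\<phi>. linear \<phi> \<and> (\<forall>y. \<bar>\<phi> y\<bar> \<le> norm y)}"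

text \<open>The cardinality is the position of \<open>i\<close> in \<open>s\<close>, counted from 0,
  so the least element must lie above \<open>b\<close>. The condition at \<open>i\<close> is
  unaffected by larger elements, as needed for initial segments.\<close>

definition alternating :: "real \<Rightarrow> real \<Rightarrow> (nat \<Rightarrow> real) \<Rightarrow> nat set \<Rightarrow> bool" where
  "alternating a b u s \<longleftrightarrow>
     (\<forall>i\<in>s. if even (card {j \<in> s. j < i}) then b < u i else u i < a)"

lemma oscillating_imp_alternating:
  fixes u :: "nat \<Rightarrow> real"
  assumes b: "infinite {n \<in> M. b < u n}" and a: "infinite {n \<in> M. u n < a}"
  obtains N where "infinite N" "N \<subseteq> M" "\<And>n. alternating a b u (N \<inter> {..<n})"
proof -
  have "\<exists>g. \<forall>k. (g k \<in> M \<and> (if even k then b < u (g k) else u (g k) < a)) \<and> g k < g (Suc k)"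
  proof (rule dependent_nat_choice)
    show "\<exists>x. x \<in> M \<and> (if even (0::nat) then b < u x else u x < a)"
      using infinite_imp_nonempty[OF b] by auto
  next
    fix x k :: nat
    have "\<exists>y>x. y \<in> {n \<in> M. b < u n}" "\<exists>y>x. y \<in> {n \<in> M. u n < a}"
      using a b unfolding infinite_nat_iff_unbounded by blast+
    then show "\<exists>y. (y \<in> M \<and> (if even (Suc k) then b < u y else u y < a)) \<and> x < y"
      by auto
  qed
  then obtain g where g: "\<And>k. g k \<in> M" "\<And>k. if even k then b < u (g k) else u (g k) < a"
    "\<And>k. g k < g (Suc k)" by blast
  have mono: "strict_mono g" using g(3) by (simp add: strict_mono_Suc_iff)
  have inj: "inj g" using mono by (rule strict_mono_imp_inj_on)
  show thesis
  proof (rule that[of "range g"])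
    show "infinite (range g)" using inj by (rule range_inj_infinite)
    show "range g \<subseteq> M" using g(1) by blast
    show "alternating a b u (range g \<inter> {..<n})" for n
      unfolding alternating_def
    proof
      fix i assume "i \<in> range g \<inter> {..<n}"
      then obtain k where k: "i = g k" "g k < n" by auto
      have "{j \<in> range g \<inter> {..<n}. j < i} = g ` {..<k}"
      proof -
        have "g j < n" if "j < k" for j using strict_monoD[OF mono that] k(2) by simp
        then show ?thesis using k mono by (auto simp: strict_mono_less)
      qed
      then have "card {j \<in> range g \<inter> {..<n}. j < i} = k"
        using inj by (simp add: card_image inj_on_subset)
      then show "if even (card {j \<in> range g \<inter> {..<n}. j < i}) then b < u i else u i < a"
        using g(2)[of k] k by simp
    qed
  qed
qed

text \<open>The elements with even index are fillers: including \<open>e (2 * n)\<close> or not adjusts the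
  parity of the position of \<open>e (2 * n + 1)\<close>.\<close>
lemma parity_pattern:
  fixes e :: "nat \<Rightarrow> nat"
  assumes e: "strict_mono e"
  shows "\<exists>s\<subseteq>e ` {..<2 * n}. \<forall>i<n. e (2 * i + 1) \<in> s \<and>
      (even (card {j \<in> s. j < e (2 * i + 1)}) \<longleftrightarrow> i \<in> P)"
proof (induction n)
  case (Suc n)
  then obtain s where s: "s \<subseteq> e ` {..<2 * n}"
    and si: "\<And>i. i < n \<Longrightarrow> e (2 * i + 1) \<in> s \<and> (even (card {j \<in> s. j < e (2 * i + 1)}) \<longleftrightarrow> i \<in> P)"
    by blast
  have fin: "finite s" using s finite_subset by blast
  have lt: "j < e (2 * n)" if "j \<in> s" for j
    using that s e by (auto simp: strict_mono_less)
  have lt': "e (2 * n) < e (2 * n + 1)" using e by (simp add: strict_mono_less)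
  define t where "t = (if even (card s) \<longleftrightarrow> n \<in> P then s else insert (e (2 * n)) s)"
  have ct: "even (card t) \<longleftrightarrow> n \<in> P"
    using fin lt by (auto simp: t_def card_insert_if)
  have tlt: "j < e (2 * n + 1)" if "j \<in> t" for j
    using that lt[of j] lt' by (auto simp: t_def split: if_splits)
  define s' where "s' = insert (e (2 * n + 1)) t"
  have "{j \<in> s'. j < e (2 * n + 1)} = t"
    using tlt by (auto simp: s'_def)
  then have n: "e (2 * n + 1) \<in> s' \<and> (even (card {j \<in> s'. j < e (2 * n + 1)}) \<longleftrightarrow> n \<in> P)"
    using ct by (simp add: s'_def)
  have "e (2 * i + 1) \<in> s' \<and> (even (card {j \<in> s'. j < e (2 * i + 1)}) \<longleftrightarrow> i \<in> P)" if "i < n" for i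
  proof -
    have "e (2 * i + 1) < e (2 * n)" using that e by (simp add: strict_mono_less)
    then have "{j \<in> s'. j < e (2 * i + 1)} = {j \<in> s. j < e (2 * i + 1)}"
      using lt' by (auto simp: s'_def t_def)
    then show ?thesis using si[OF that] by (auto simp: s'_def t_def)
  qed
  then have "\<forall>i<Suc n. e (2 * i + 1) \<in> s' \<and> (even (card {j \<in> s'. j < e (2 * i + 1)}) \<longleftrightarrow> i \<in> P)"
    using n less_Suc_eq by auto
  moreover have "s' \<subseteq> e ` {..<2 * Suc n}"
    using s by (auto simp: s'_def t_def split: if_splits)
  ultimately show ?case by blast
qed simp

text \<open>For given coefficients, \<open>\<phi>\<close> is large where they are nonnegative and
  small elsewhere, and \<open>\<psi>\<close> is the reverse. Their difference gains
  \<open>b - a\<close> times each absolute coefficient while its norm is at most 2; hence the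
  constant \<open>(b - a) / 2\<close>.\<close>

lemma independent_imp_contains_l1:
  fixes y :: "nat \<Rightarrow> 'a::real_normed_vector"
  assumes ab: "a < b" and y: "\<And>n. norm (y n) \<le> 1"
    and ind: "\<And>n P. \<exists>\<phi>\<in>dual_ball. \<forall>i<n. if i \<in> P then b < \<phi> (y i) else \<phi> (y i) < a"
  shows "contains_l1 TYPE('a)"
  unfolding contains_l1_def
proof (intro exI conjI allI)
  show "0 < (b - a) / 2" using ab by simp
  fix \<alpha> :: "nat \<Rightarrow> real" and n
  let ?v = "\<Sum>i<n. \<alpha> i *\<^sub>R y i"
  have "norm ?v \<le> (\<Sum>i<n. norm (\<alpha> i *\<^sub>R y i))" by (rule norm_sum)
  also have "\<dots> \<le> (\<Sum>i<n. \<bar>\<alpha> i\<bar>)"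
    using y by (intro sum_mono) (simp add: mult_left_le)
  finally show "norm ?v \<le> 1 * (\<Sum>i<n. \<bar>\<alpha> i\<bar>)" by simp
  obtain \<phi> where \<phi>: "\<phi> \<in> dual_ball" "\<And>i. i < n \<Longrightarrow> if i \<in> {i. 0 \<le> \<alpha> i} then b < \<phi> (y i) else \<phi> (y i) < a"
    using ind[of n "{i. 0 \<le> \<alpha> i}"] by blast
  obtain \<psi> where \<psi>: "\<psi> \<in> dual_ball" "\<And>i. i < n \<Longrightarrow> if i \<in> {i. \<alpha> i < 0} then b < \<psi> (y i) else \<psi> (y i) < a"
    using ind[of n "{i. \<alpha> i < 0}"] by blast
  have lin: "linear \<phi>" "linear \<psi>" using \<phi>(1) \<psi>(1) by auto
  have "(b - a) * \<bar>\<alpha> i\<bar> \<le> \<alpha> i * (\<phi> (y i) - \<psi> (y i))" if "i < n" for i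
  proof (cases "0 \<le> \<alpha> i")
    case True
    then have "b - a \<le> \<phi> (y i) - \<psi> (y i)" using \<phi>(2)[OF that] \<psi>(2)[OF that] by auto
    then show ?thesis using mult_left_mono[of "b - a" "\<phi> (y i) - \<psi> (y i)" "\<alpha> i"] True by (simp add: mult.commute)
  next
    case False
    then have "b - a \<le> \<psi> (y i) - \<phi> (y i)" using \<phi>(2)[OF that] \<psi>(2)[OF that] by auto
    then show ?thesis using mult_left_mono[of "b - a" "\<psi> (y i) - \<phi> (y i)" "- \<alpha> i"] False by (simp add: algebra_simps)
  qed
  then have "(b - a) * (\<Sum>i<n. \<bar>\<alpha> i\<bar>) \<le> (\<Sum>i<n. \<alpha> i * (\<phi> (y i) - \<psi> (y i)))"
    unfolding sum_distrib_left by (intro sum_mono) auto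
  also have "\<dots> = \<phi> ?v - \<psi> ?v"
    using lin by (simp add: linear_sum linear_cmul algebra_simps sum_subtractf)
  also have "\<dots> \<le> 2 * norm ?v"
  proof -
    have "\<bar>\<phi> ?v\<bar> \<le> norm ?v" "\<bar>\<psi> ?v\<bar> \<le> norm ?v" using \<phi>(1) \<psi>(1) by auto
    then show ?thesis by linarith
  qed
  finally show "(b - a) / 2 * (\<Sum>i<n. \<bar>\<alpha> i\<bar>) \<le> norm ?v" by simp
qed

text \<open>The Ramsey theorem is applied to the sets on which no functional of the dual ball
  alternates. If each infinite set carried an oscillating functional, the second alternative would
  fail. The first makes every finite subset of \<open>M\<close> alternating for some functional, and
  \<open>parity_pattern\<close> turns this into independence of the odd-indexed elements, hence a
  copy of \<open>\<ell>\<^sub>1\<close>.\<close>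

lemma no_l1_nonoscillating_subset:
  fixes x :: "nat \<Rightarrow> 'a::real_normed_vector"
  assumes l1: "\<not> contains_l1 TYPE('a)" and x: "\<And>n. norm (x n) \<le> 1" and ab: "a < b"
  obtains M where "infinite M"
    "\<And>\<phi>. \<phi> \<in> dual_ball \<Longrightarrow> finite {n \<in> M. b < \<phi> (x n)} \<or> finite {n \<in> M. \<phi> (x n) < a}"
proof (rule ccontr)
  assume "\<not> thesis"
  then have osc: "\<exists>\<phi>\<in>dual_ball. infinite {n \<in> M. b < \<phi> (x n)} \<and> infinite {n \<in> M. \<phi> (x n) < a}"
    if "infinite M" for M
    using that \<open>\<And>M. infinite M \<Longrightarrow> (\<And>\<phi>. \<phi> \<in> dual_ball \<Longrightarrow> finite {n \<in> M. b < \<phi> (x n)} \<or>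
        finite {n \<in> M. \<phi> (x n) < a}) \<Longrightarrow> thesis\<close> by blast
  define \<F> where "\<F> = {s. \<not> (\<exists>\<phi>\<in>dual_ball. alternating a b (\<lambda>n. \<phi> (x n)) s)}"
  show False
  proof (rule Galvin_Nash_Williams[of \<F>])
    fix M assume M: "infinite M" "\<And>N. infinite N \<Longrightarrow> N \<subseteq> M \<Longrightarrow> \<exists>n. N \<inter> {..<n} \<in> \<F>"
    obtain \<phi> where \<phi>: "\<phi> \<in> dual_ball" "infinite {n \<in> M. b < \<phi> (x n)}" "infinite {n \<in> M. \<phi> (x n) < a}"
      using osc[OF M(1)] by blast
    obtain N where N: "infinite N" "N \<subseteq> M" "\<And>n. alternating a b (\<lambda>n. \<phi> (x n)) (N \<inter> {..<n})"
      using oscillating_imp_alternating[OF \<phi>(2,3)] by blast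
    show False using M(2)[OF N(1,2)] N(3) \<phi>(1) unfolding \<F>_def by blast
  next
    fix M assume M: "infinite M" "\<And>s. finite s \<Longrightarrow> s \<subseteq> M \<Longrightarrow> s \<notin> \<F>"
    define e where "e = enumerate M"
    have e: "strict_mono e" "\<And>n. e n \<in> M"
      using M(1) by (auto simp: e_def strict_mono_enumerate enumerate_in_set)
    have "contains_l1 TYPE('a)"
    proof (rule independent_imp_contains_l1[OF ab, of "\<lambda>i. x (e (2 * i + 1))"])
      fix n and P :: "nat set"
      obtain s where s: "s \<subseteq> e ` {..<2 * n}" "\<And>i. i < n \<Longrightarrow> e (2 * i + 1) \<in> s \<and>
          (even (card {j \<in> s. j < e (2 * i + 1)}) \<longleftrightarrow> i \<in> P)"
        using parity_pattern[OF e(1), of n P] by blast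
      have "finite s" "s \<subseteq> M" using s(1) e(2) finite_subset by blast+
      then obtain \<phi> where \<phi>: "\<phi> \<in> dual_ball" "alternating a b (\<lambda>n. \<phi> (x n)) s"
        using M(2)[of s] unfolding \<F>_def by blast
      then show "\<exists>\<phi>\<in>dual_ball. \<forall>i<n. if i \<in> P then b < \<phi> (x (e (2 * i + 1)))
          else \<phi> (x (e (2 * i + 1))) < a"
        using s(2) unfolding alternating_def by (intro bexI[of _ \<phi>]) auto
    qed (rule x)
    then show False using l1 by simp
  qed
qed

text \<open>Let \<open>l\<close> be a subsequential limit and \<open>l < c\<close>. For rationals
  \<open>a < b\<close> between them infinitely many terms lie below \<open>a\<close>, so only
  finitely many lie above \<open>b\<close>; the other side is symmetric. Rational levels leave only
  countably many conditions for a diagonal argument.\<close>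

lemma bounded_nonoscillating_convergent:
  fixes u :: "nat \<Rightarrow> real"
  assumes bd: "\<And>n. \<bar>u n\<bar> \<le> B"
    and osc: "\<And>a b :: rat. a < b \<Longrightarrow> finite {n. of_rat b < u n} \<or> finite {n. u n < of_rat a}"
  shows "convergent u"
proof -
  have "bounded (range u)" using bd by (auto simp: bounded_iff)
  then obtain l r where r: "strict_mono r" "(u \<circ> r) \<longlonglongrightarrow> l"
    using bounded_imp_convergent_subsequence by blast
  have inj: "inj r" using r(1) by (rule strict_mono_imp_inj_on)
  have above: "eventually (\<lambda>n. u n < c) sequentially" if c: "l < c" for c
  proof -
    obtain b :: rat where b: "l < of_rat b" "of_rat b < c" using of_rat_dense[OF c] by blast
    obtain a :: rat where a: "l < of_rat a" "of_rat a < (of_rat b :: real)"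
      using of_rat_dense[OF b(1)] by blast
    have "eventually (\<lambda>k. u (r k) < of_rat a) sequentially"
      using order_tendstoD(2)[OF r(2) a(1)] by simp
    then obtain K where K: "\<And>k. K \<le> k \<Longrightarrow> u (r k) < of_rat a"
      unfolding eventually_sequentially by blast
    have "infinite {n. u n < of_rat a}"
    proof
      assume "finite {n. u n < of_rat a}"
      moreover have "r ` {K..} \<subseteq> {n. u n < of_rat a}" using K by auto
      ultimately have "finite (r ` {K..})" by (rule rev_finite_subset)
      then show False using finite_imageD[of r "{K..}"] inj infinite_Ici[of K] inj_on_subset by blast
    qed
    then have "finite {n. of_rat b < u n}" using osc[of a b] a(2) by (auto simp: of_rat_less)
    then have "eventually (\<lambda>n. \<not> of_rat b < u n) sequentially"
      by (simp add: eventually_cofinite cofinite_eq_sequentially[symmetric])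
    then show ?thesis by (rule eventually_mono) (use b(2) in auto)
  qed
  have below: "eventually (\<lambda>n. c < u n) sequentially" if c: "c < l" for c
  proof -
    obtain a :: rat where a: "c < of_rat a" "of_rat a < l" using of_rat_dense[OF c] by blast
    obtain b :: rat where b: "of_rat a < (of_rat b :: real)" "of_rat b < l"
      using of_rat_dense[OF a(2)] by blast
    have "eventually (\<lambda>k. of_rat b < u (r k)) sequentially"
      using order_tendstoD(1)[OF r(2) b(2)] by simp
    then obtain K where K: "\<And>k. K \<le> k \<Longrightarrow> of_rat b < u (r k)"
      unfolding eventually_sequentially by blast
    have "infinite {n. of_rat b < u n}"
    proof
      assume "finite {n. of_rat b < u n}"
      moreover have "r ` {K..} \<subseteq> {n. of_rat b < u n}" using K by auto
      ultimately have "finite (r ` {K..})" by (rule rev_finite_subset)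
      then show False using finite_imageD[of r "{K..}"] inj infinite_Ici[of K] inj_on_subset by blast
    qed
    then have "finite {n. u n < of_rat a}" using osc[of a b] b(1) by (auto simp: of_rat_less)
    then have "eventually (\<lambda>n. \<not> u n < of_rat a) sequentially"
      by (simp add: eventually_cofinite cofinite_eq_sequentially[symmetric])
    then show ?thesis by (rule eventually_mono) (use a(1) in auto)
  qed
  have "u \<longlonglongrightarrow> l" using above below by (rule order_tendstoI[rotated])
  then show ?thesis by (auto simp: convergent_def)
qed

lemma finite_preimage_strict_mono:
  fixes r :: "nat \<Rightarrow> nat"
  assumes "strict_mono r" "finite {n. P n}"
  shows "finite {n. P (r n)}"
  using finite_vimageI[OF assms(2) strict_mono_imp_inj_on[OF assms(1)]] by (simp add: vimage_def)

text \<open>Diagonalization over all pairs of rational levels gives a subsequence on which no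
  functional of the dual ball oscillates; scaling then covers all bounded functionals.\<close>

theorem Rosenthal_l1:
  fixes x :: "nat \<Rightarrow> 'a::real_normed_vector"
  assumes l1: "\<not> contains_l1 TYPE('a)" and x: "\<And>n. norm (x n) \<le> 1"
  obtains r where "strict_mono r"
    "\<And>\<phi> :: 'a \<Rightarrow> real. bounded_linear \<phi> \<Longrightarrow> convergent (\<lambda>n. \<phi> (x (r n)))"
proof -
  \<comment> \<open>Requirement \<open>k\<close> concerns the pair of rationals coded by
    \<open>k\<close> and is vacuous unless \<open>a < b\<close>.\<close>
  define tame where "tame k s \<longleftrightarrow> (case from_nat k :: rat \<times> rat of (a, b) \<Rightarrow> a < b \<longrightarrow>
      (\<forall>\<phi>\<in>dual_ball. finite {n. of_rat b < \<phi> (x (s n))} \<or> finite {n. \<phi> (x (s n)) < of_rat a}))"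
    for k and s :: "nat \<Rightarrow> nat"
  interpret subseqs tame
  proof
    fix k and s :: "nat \<Rightarrow> nat" assume "strict_mono s"
    obtain a b :: rat where ab: "from_nat k = (a, b)" by force
    show "\<exists>r'. strict_mono r' \<and> tame k (s \<circ> r')"
    proof (cases "a < b")
      case True
      then have ab': "(of_rat a :: real) < of_rat b" by (simp add: of_rat_less)
      have xs: "norm (x (s n)) \<le> 1" for n by (rule x)
      obtain M where M: "infinite M" "\<And>\<phi>. \<phi> \<in> dual_ball \<Longrightarrow>
          finite {n \<in> M. of_rat b < \<phi> (x (s n))} \<or> finite {n \<in> M. \<phi> (x (s n)) < of_rat a}"
        by (rule no_l1_nonoscillating_subset[where x = "\<lambda>n. x (s n)", OF l1 xs ab'], rule that)
      have e: "strict_mono (enumerate M)" using M(1) by (rule strict_mono_enumerate)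
      have "tame k (s \<circ> enumerate M)"
        unfolding tame_def ab
      proof (clarsimp)
        fix \<phi> :: "'a \<Rightarrow> real"
        assume "linear \<phi>" "\<forall>y. \<bar>\<phi> y\<bar> \<le> norm y"
          and inf: "infinite {n. \<phi> (x (s (enumerate M n))) < real_of_rat a}"
        then have "finite {n \<in> M. of_rat b < \<phi> (x (s n))} \<or> finite {n \<in> M. \<phi> (x (s n)) < of_rat a}"
          by (intro M(2)) auto
        then show "finite {n. real_of_rat b < \<phi> (x (s (enumerate M n)))}"
          using finite_preimage_strict_mono[OF e, of "\<lambda>n. n \<in> M \<and> of_rat b < \<phi> (x (s n))"]
            finite_preimage_strict_mono[OF e, of "\<lambda>n. n \<in> M \<and> \<phi> (x (s n)) < of_rat a"]
            inf enumerate_in_set[OF M(1)] by auto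
      qed
      then show ?thesis using e by blast
    next
      case False
      then show ?thesis by (intro exI[of _ id]) (auto simp: tame_def ab strict_mono_id)
    qed
  qed
  have stable: "tame k (s \<circ> r)" if r: "strict_mono r" and s: "tame k s" for r s k
  proof -
    obtain a b :: rat where ab: "from_nat k = (a, b)" by force
    show ?thesis
      using s finite_preimage_strict_mono[OF r] unfolding tame_def ab by fastforce
  qed
  \<comment> \<open>The diagonal sequence is known to meet requirement \<open>k\<close> after the
    shift by \<open>Suc k\<close>; the finitely many skipped indices do not affect
    finiteness.\<close>
  have tail: "tame k (diagseq \<circ> ((+) (Suc k)))" for k
    by (rule diagseq_holds) (rule stable)
  have conv: "convergent (\<lambda>n. \<phi> (x (diagseq n)))" if \<phi>: "\<phi> \<in> dual_ball" for \<phi>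
  proof (rule bounded_nonoscillating_convergent)
    show "\<bar>\<phi> (x (diagseq n))\<bar> \<le> 1" for n
      using \<phi> x[of "diagseq n"] by (auto intro: order_trans)
    fix a b :: rat assume "a < b"
    define k where "k = to_nat (a, b)"
    have "from_nat k = (a, b)" by (simp add: k_def)
    then have "finite {n. of_rat b < \<phi> (x (diagseq (n + Suc k)))} \<or>
        finite {n. \<phi> (x (diagseq (n + Suc k))) < of_rat a}"
      using tail[of k] \<phi> \<open>a < b\<close> unfolding tame_def by (simp add: add.commute)
    note tail_finite = this
    have shift: "finite {n. P n}" if "finite {n. P (n + Suc k)}" for P :: "nat \<Rightarrow> bool"
    proof -
      have "{n. P n} \<subseteq> {..Suc k} \<union> (\<lambda>n. n + Suc k) ` {n. P (n + Suc k)}"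
      proof
        fix n assume "n \<in> {n. P n}"
        then show "n \<in> {..Suc k} \<union> (\<lambda>n. n + Suc k) ` {n. P (n + Suc k)}"
          by (cases "n \<le> Suc k") (auto intro!: image_eqI[of _ _ "n - Suc k"])
      qed
      then show ?thesis using that by (meson finite_UnI finite_atMost finite_imageI finite_subset)
    qed
    show "finite {n. of_rat b < \<phi> (x (diagseq n))} \<or> finite {n. \<phi> (x (diagseq n)) < of_rat a}"
      using tail_finite shift[of "\<lambda>n. of_rat b < \<phi> (x (diagseq n))"]
        shift[of "\<lambda>n. \<phi> (x (diagseq n)) < of_rat a"] by argo
  qed
  show thesis
  proof (rule that[OF subseq_diagseq])
    fix \<phi> :: "'a \<Rightarrow> real" assume "bounded_linear \<phi>"
    then interpret \<phi>: bounded_linear \<phi> .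
    obtain K where K: "K > 0" "\<And>y. norm (\<phi> y) \<le> norm y * K" using \<phi>.pos_bounded by blast
    \<comment> \<open>Dividing by an operator bound moves the functional into the dual ball, where
      convergence is known.\<close>
    have "(\<lambda>y. \<phi> y / K) \<in> dual_ball"
      using K by (auto simp: linear_iff \<phi>.add \<phi>.scaleR add_divide_distrib divide_le_eq)
    then have "convergent (\<lambda>n. K * (\<phi> (x (diagseq n)) / K))"
      by (intro convergent_mult convergent_const conv)
    then show "convergent (\<lambda>n. \<phi> (x (diagseq n)))" using K(1) by simp
  qed
qed

section \<open>Semi-normalized weakly null sequences\<close>

lemma separated_sequence:
  assumes inf: "infinite_dimensional TYPE('a::real_normed_vector)"
  obtains x :: "nat \<Rightarrow> 'a::real_normed_vector" where "\<And>n. norm (x n) = 1" "\<And>m n. m < n \<Longrightarrow> 1 / 2 \<le> norm (x n - x m)"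
proof -
  \<comment> \<open>Riesz's lemma: with \<open>d\<close> the positive distance from \<open>z\<close>
    to the closed span and \<open>e\<close> at distance \<open>c < 2 * d\<close> from
    \<open>z\<close>, the normalized difference is at distance at least \<open>d / c > 1 / 2\<close>
    from the span.\<close>
  have ext: "\<exists>v :: 'a. norm v = 1 \<and> (\<forall>w\<in>F. 1 / 2 \<le> norm (v - w))" if F: "finite F" for F
  proof -
    obtain z where z: "z \<notin> span F"
      using inf F unfolding infinite_dimensional_def by blast
    define d where "d = infdist z (span F)"
    have d: "d > 0"
      unfolding d_def using z closed_span_finite[OF F] span_zero
      by (intro infdist_pos_not_in_closed) auto
    have "(INF a\<in>span F. dist z a) < 2 * d"
    proof -
      have "span F \<noteq> {}" using span_zero[of F] by auto
      then show ?thesis using d by (simp add: d_def infdist_notempty)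
    qed
    then obtain e where e: "e \<in> span F" "dist z e < 2 * d"
      using span_zero[of F] by (subst (asm) cINF_less_iff) (auto intro!: bdd_belowI2[of _ 0])
    define c where "c = norm (z - e)"
    have c: "0 < c" "c < 2 * d" using e z by (auto simp: c_def dist_norm)
    have "1 / 2 \<le> norm ((z - e) /\<^sub>R c - w)" if "w \<in> F" for w
    proof -
      have "e + c *\<^sub>R w \<in> span F" using e(1) that by (simp add: span_add span_base span_scale)
      then have "d \<le> norm (z - (e + c *\<^sub>R w))"
        unfolding d_def by (metis dist_norm infdist_le)
      also have "z - (e + c *\<^sub>R w) = c *\<^sub>R ((z - e) /\<^sub>R c - w)"
        using c(1) by (simp add: algebra_simps)
      finally have "d \<le> c * norm ((z - e) /\<^sub>R c - w)" using c(1) by simp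
      then have "c * (1 / 2) \<le> c * norm ((z - e) /\<^sub>R c - w)" using c(2) by linarith
      then show ?thesis using c(1) by (simp only: mult_le_cancel_left_pos)
    qed
    moreover have "norm ((z - e) /\<^sub>R c) = 1" using c(1) by (simp add: c_def)
    ultimately show ?thesis by blast
  qed
  have "\<exists>f :: nat \<Rightarrow> 'a. \<forall>n. norm (f n) = 1 \<and> (\<forall>w\<in>f ` {..<n}. 1 / 2 \<le> norm (f n - w))"
  proof -
    define P where "P f n v \<longleftrightarrow> norm v = 1 \<and> (\<forall>w\<in>f ` {..<n}. 1 / 2 \<le> norm (v - w))"
      for f :: "nat \<Rightarrow> 'a" and n v
    have "\<exists>f. \<forall>n. P f n (f n)"
    proof (rule dependent_wf_choice[OF wf_less])
      show "P f n v = P g n v" if "\<And>m. (m, n) \<in> {(x, y). x < y} \<Longrightarrow> f m = g m" for f g n v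
        using that by (auto simp: P_def)
      show "\<exists>v. P f n v" for n f
        using ext[of "f ` {..<n}"] by (simp add: P_def)
    qed
    then show ?thesis by (simp add: P_def)
  qed
  then obtain f :: "nat \<Rightarrow> 'a" where "\<And>n. norm (f n) = 1" "\<And>n. \<forall>w\<in>f ` {..<n}. 1 / 2 \<le> norm (f n - w)"
    by blast
  then show thesis using that[of f] by auto
qed

text \<open>Differences of consecutive terms of a weakly Cauchy subsequence are weakly null, and
  separation of the original sequence keeps them away from 0.\<close>

lemma semi_normalized_weakly_null_exists:
  assumes inf: "infinite_dimensional TYPE('a::real_normed_vector)" and l1: "\<not> contains_l1 TYPE('a::real_normed_vector)"
  obtains y :: "nat \<Rightarrow> 'a::real_normed_vector" where "semi_normalized y" "weakly_null y"
proof -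
  obtain x :: "nat \<Rightarrow> 'a" where x: "\<And>n. norm (x n) = 1" "\<And>m n. m < n \<Longrightarrow> 1 / 2 \<le> norm (x n - x m)"
    using separated_sequence[OF inf] by blast
  obtain r where r: "strict_mono r"
    "\<And>\<phi> :: 'a \<Rightarrow> real. bounded_linear \<phi> \<Longrightarrow> convergent (\<lambda>n. \<phi> (x (r n)))"
    using Rosenthal_l1[OF l1, of x] x(1) by (metis order_refl)
  define y where "y n = x (r (2 * n + 1)) - x (r (2 * n))" for n
  have "1 / 2 \<le> norm (y n)" for n
    unfolding y_def using r(1) by (intro x(2)) (simp add: strict_mono_less)
  moreover have "norm (y n) \<le> 2" for n
    using norm_triangle_ineq4[of "x (r (2 * n + 1))" "x (r (2 * n))"] by (simp add: y_def x(1))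
  ultimately have "semi_normalized y"
    unfolding semi_normalized_def by (intro exI[of _ "1 / 2"] exI[of _ 2]) auto
  moreover have "weakly_null y"
    unfolding weakly_null_def
  proof (intro allI impI)
    fix \<phi> :: "'a \<Rightarrow> real" assume \<phi>: "bounded_linear \<phi>"
    obtain l where l: "(\<lambda>n. \<phi> (x (r n))) \<longlonglongrightarrow> l" using r(2)[OF \<phi>] by (auto simp: convergent_def)
    have "(\<lambda>n. \<phi> (x (r (2 * n + 1))) - \<phi> (x (r (2 * n)))) \<longlonglongrightarrow> l - l"
      using LIMSEQ_subseq_LIMSEQ[OF l, of "\<lambda>n. 2 * n + 1"] LIMSEQ_subseq_LIMSEQ[OF l, of "\<lambda>n. 2 * n"]
      by (intro tendsto_diff) (auto simp: strict_mono_def o_def)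
    then show "(\<lambda>n. \<phi> (y n)) \<longlonglongrightarrow> 0"
      by (simp add: y_def bounded_linear.linear[OF \<phi>] linear_diff)
  qed
  ultimately show thesis by (rule that)
qed

section \<open>Coarse embeddings\<close>

lemma omega_finite_bound:
  fixes f :: "'a::real_normed_vector \<Rightarrow> 'b::real_normed_vector"
  assumes "omega f t < \<infinity>"
  obtains L where "0 < L" "\<And>x y. norm (x - y) \<le> t \<Longrightarrow> norm (f x - f y) \<le> L"
proof -
  obtain K where K: "omega f t \<le> ereal K"
    using assms by (cases "omega f t") auto
  show thesis
  \<comment> \<open>The maximum with 1 makes the bound strictly positive.\<close>
  proof (rule that[of "max 1 K"])
    fix x y :: 'a assume "norm (x - y) \<le> t"
    then have "ereal (norm (f x - f y)) \<le> omega f t"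
      unfolding omega_def by (intro Sup_upper) auto
    then have "ereal (norm (f x - f y)) \<le> ereal K" using K by (rule order_trans)
    then show "norm (f x - f y) \<le> max 1 K" by simp
  qed simp
qed

lemma rho_le:
  assumes "t \<le> norm (x - y)"
  shows "rho f t \<le> ereal (norm (f x - f y))"
  unfolding rho_def using assms by (intro Inf_lower) auto

lemma rho_bound:
  fixes f :: "'a::real_normed_vector \<Rightarrow> 'b::real_normed_vector" and z :: "nat \<Rightarrow> 'a"
  assumes q: "1 < q" and refl: "reflexive_space TYPE('b)"
    and C: "0 < C" "\<And>t. t \<in> {0..1} \<Longrightarrow> aus_modulus TYPE('b) t \<le> ereal (C * t powr q)"
    and z: "weakly_null z"
    and low: "\<And>k J. finite J \<Longrightarrow> card J = k \<Longrightarrow> (\<And>j. j \<in> J \<Longrightarrow> k \<le> j) \<Longrightarrow>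
        2 * real k powr (1 / p) \<le> norm (\<Sum>j\<in>J. z j)"
    and L: "0 < L" "\<And>m n u. norm (f (u + z m) - f (u + z n)) \<le> L"
    and k: "1 \<le> k"
  shows "rho f (real k powr (1 / p)) \<le> ereal (2 * ((2 + 2 * C) * L) * real k powr (1 / q))"
proof -
  obtain U where U: "free_ultrafilter U" using free_ultrafilter_exists by blast
  then have nb: "U \<noteq> bot" and seq: "U \<le> sequentially" by (auto simp: free_ultrafilter_def)
  define h where "h ns = (\<Sum>n\<leftarrow>ns. z n)" for ns
  define B where "B = ((2 + 2 * C) * L) * real k powr (1 / q)"
  \<comment> \<open>Isolates one coordinate, so that the hypothesis on
    \<open>f (u + z m) - f (u + z n)\<close> yields the Lipschitz condition on tuples.\<close>
  have hsplit: "h (as @ a # bs) = (h as + h bs) + z a" for as a bs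
    by (simp add: h_def)
  obtain y where y: "iter_eventually U k
      (\<lambda>ns. norm (f (h ns) - y) powr q \<le> real k * ((2 + 2 * C) * L) powr q)"
    using Hamming_Lipschitz_concentration[OF refl U q C L(1), of k "\<lambda>ns. f (h ns)"] L(2)
    by (auto simp: hsplit)
  have yB: "iter_eventually U k (\<lambda>ns. norm (f (h ns) - y) \<le> B)"
    using y
  proof (rule iter_eventually_mono)
    fix ns :: "nat list"
    assume "norm (f (h ns) - y) powr q \<le> real k * ((2 + 2 * C) * L) powr q"
    also have "\<dots> = B powr q"
      using C(1) L(1) q k by (simp add: B_def powr_mult powr_powr)
    finally have "norm (f (h ns) - y) powr q \<le> B powr q" .
    moreover have "0 \<le> B" using C(1) L(1) by (simp add: B_def)
    ultimately show "norm (f (h ns) - y) \<le> B"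
      using powr_less_mono2[of q B "norm (f (h ns) - y)"] q by linarith
  qed
  \<comment> \<open>Secures the conditions for the lower estimate \<open>low\<close>: large sets of
    \<open>U\<close> contain indices exceeding \<open>k\<close> and all earlier choices.\<close>
  have "iter_eventually U k (\<lambda>ns. distinct ns \<and> (\<forall>n\<in>set ns. k \<le> n))"
  proof (rule iter_eventually_extend)
    fix ns :: "nat list" assume ns: "distinct ns \<and> (\<forall>n\<in>set ns. k \<le> n)"
    have "\<forall>\<^sub>F n in sequentially. Max (insert k (set ns)) < n"
      by (rule eventually_gt_at_top)
    then have "\<forall>\<^sub>F n in U. Max (insert k (set ns)) < n"
      using seq by (rule filter_leD[rotated])
    then show "\<forall>\<^sub>F n in U. distinct (ns @ [n]) \<and> (\<forall>m\<in>set (ns @ [n]). k \<le> m)"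
      by (rule eventually_mono) (use ns in auto)
  qed simp
  then have "iter_eventually U k (\<lambda>ns. norm (f (h ns) - y) \<le> B \<and> distinct ns \<and> (\<forall>n\<in>set ns. k \<le> n))"
    by (rule iter_eventually_conj[OF yB])
  then obtain ns where ns: "length ns = k" "norm (f (h ns) - y) \<le> B" "distinct ns" "\<forall>n\<in>set ns. k \<le> n"
    using iter_eventually_ex[OF _ nb] by blast
  have "h ns = (\<Sum>j\<in>set ns. z j)"
    unfolding h_def using ns(3) by (rule sum_list_distinct_conv_sum_set)
  then have hns: "2 * real k powr (1 / p) \<le> norm (h ns)"
    using low[of "set ns" k] ns by (simp add: distinct_card)
  obtain \<phi> :: "'a \<Rightarrow> real" where \<phi>: "bounded_linear \<phi>" "\<And>x. \<bar>\<phi> x\<bar> \<le> norm x" "\<phi> (h ns) = norm (h ns)"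
    using norming_functional[of "h ns"] by blast
  interpret \<phi>: bounded_linear \<phi> by (rule \<phi>(1))
  \<comment> \<open>Chosen so that \<open>k\<close> values of size \<open>\<eta>\<close> add up to
    \<open>real k powr (1 / p)\<close>, half of the lower bound for
    \<open>\<phi> (h ns)\<close>.\<close>
  define \<eta> where "\<eta> = real k powr (1 / p) / real k"
  have \<eta>: "\<eta> > 0" using k by (simp add: \<eta>_def)
  \<comment> \<open>The second tuple is chosen after \<open>\<phi>\<close>, which depends on the
    first; weak nullity of \<open>z\<close> makes the values small along \<open>U\<close>.\<close>
  have "iter_eventually U k (\<lambda>ms. \<forall>m\<in>set ms. \<bar>\<phi> (z m)\<bar> \<le> \<eta>)"
  proof (rule iter_eventually_extend)
    fix ms :: "nat list" assume ms: "\<forall>m\<in>set ms. \<bar>\<phi> (z m)\<bar> \<le> \<eta>"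
    have "(\<lambda>n. \<phi> (z n)) \<longlonglongrightarrow> 0" using z \<phi>(1) by (simp add: weakly_null_def)
    then have "\<forall>\<^sub>F n in sequentially. \<bar>\<phi> (z n)\<bar> < \<eta>"
      using tendstoD[OF _ \<eta>] by fastforce
    then have "\<forall>\<^sub>F n in U. \<bar>\<phi> (z n)\<bar> < \<eta>"
      using seq by (rule filter_leD[rotated])
    then show "\<forall>\<^sub>F n in U. \<forall>m\<in>set (ms @ [n]). \<bar>\<phi> (z m)\<bar> \<le> \<eta>"
      by (rule eventually_mono) (use ms in auto)
  qed simp
  then have "iter_eventually U k (\<lambda>ms. norm (f (h ms) - y) \<le> B \<and> (\<forall>m\<in>set ms. \<bar>\<phi> (z m)\<bar> \<le> \<eta>))"
    by (rule iter_eventually_conj[OF yB])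
  then obtain ms where ms: "length ms = k" "norm (f (h ms) - y) \<le> B" "\<forall>m\<in>set ms. \<bar>\<phi> (z m)\<bar> \<le> \<eta>"
    using iter_eventually_ex[OF _ nb] by blast
  have "\<phi> (h ms) \<le> real (length ms) * \<eta>"
    using ms(3) unfolding h_def
    by (induction ms) (auto simp: \<phi>.zero \<phi>.add algebra_simps abs_le_iff intro: add_mono)
  also have "\<dots> = real k powr (1 / p)" using ms(1) k by (simp add: \<eta>_def)
  finally have "real k powr (1 / p) \<le> \<phi> (h ns - h ms)"
    using hns \<phi>(3) by (simp add: \<phi>.diff)
  also have "\<dots> \<le> norm (h ns - h ms)" using \<phi>(2) abs_le_D1 by blast
  finally have "rho f (real k powr (1 / p)) \<le> ereal (norm (f (h ns) - f (h ms)))"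
    by (rule rho_le)
  also have "norm (f (h ns) - f (h ms)) \<le> 2 * B"
    using norm_triangle_ineq4[of "f (h ns) - y" "f (h ms) - y"] ns(2) ms(2) by simp
  finally show ?thesis by (simp add: B_def mult.assoc)
qed

theorem theorem4p1:
  fixes p q :: real
  assumes "1 < p" and "1 < q"
    and "infinite_dimensional TYPE('a::banach)"
    and "co_banach_saks TYPE('a) p"
    and "\<not> contains_l1 TYPE('a)"
    and "reflexive_space TYPE('b::banach)"
    and "asympt_unif_smooth TYPE('b) q"
  shows "\<not> (\<exists>f :: 'a \<Rightarrow> 'b. coarse_embedding f \<and>
           limsup (\<lambda>k::nat. rho f (real k powr (1 / p)) / ereal (real k powr (1 / q))) = \<infinity>)"
proof
  assume "\<exists>f :: 'a \<Rightarrow> 'b. coarse_embedding f \<and>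
           limsup (\<lambda>k::nat. rho f (real k powr (1 / p)) / ereal (real k powr (1 / q))) = \<infinity>"
  then obtain f :: "'a \<Rightarrow> 'b" where f: "coarse_embedding f"
    and lim: "limsup (\<lambda>k::nat. rho f (real k powr (1 / p)) / ereal (real k powr (1 / q))) = \<infinity>"
    by blast
  obtain x :: "nat \<Rightarrow> 'a" where x: "semi_normalized x" "weakly_null x"
    using semi_normalized_weakly_null_exists[OF assms(3,5)] by blast
  obtain b where b: "\<And>n. norm (x n) \<le> b"
    using x(1) unfolding semi_normalized_def by blast
  obtain r c where r: "strict_mono r" and c: "c > 0"
    and low: "\<And>k J. finite J \<and> card J = k \<and> (\<forall>j\<in>J. k \<le> j) \<Longrightarrow>
        c * real k powr (1 / p) \<le> norm (\<Sum>j\<in>J. x (r j))"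
    using assms(4) x unfolding co_banach_saks_def by blast
  \<comment> \<open>The factor normalizes the lower constant \<open>c\<close> to 2, which leaves
    \<open>real k powr (1 / p)\<close> after the second tuple is subtracted.\<close>
  define z where "z n = (2 / c) *\<^sub>R x (r n)" for n
  have z: "weakly_null z"
    unfolding weakly_null_def
  proof (intro allI impI)
    fix \<phi> :: "'a \<Rightarrow> real" assume \<phi>: "bounded_linear \<phi>"
    then have "(\<lambda>n. \<phi> (x n)) \<longlonglongrightarrow> 0" using x(2) by (simp add: weakly_null_def)
    then have "(\<lambda>n. \<phi> (x (r n))) \<longlonglongrightarrow> 0"
      using LIMSEQ_subseq_LIMSEQ[OF _ r] by (fastforce simp: o_def)
    then have "(\<lambda>n. (2 / c) * \<phi> (x (r n))) \<longlonglongrightarrow> (2 / c) * 0" by (intro tendsto_intros)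
    then show "(\<lambda>n. \<phi> (z n)) \<longlonglongrightarrow> 0"
      by (simp add: z_def linear_cmul[OF bounded_linear.linear[OF \<phi>]])
  qed
  have zlow: "2 * real k powr (1 / p) \<le> norm (\<Sum>j\<in>J. z j)"
    if "finite J" "card J = k" "\<And>j. j \<in> J \<Longrightarrow> k \<le> j" for k J
  proof -
    have "(2 / c) * (c * real k powr (1 / p)) \<le> (2 / c) * norm (\<Sum>j\<in>J. x (r j))"
      using low[of J k] that c by (intro mult_left_mono) auto
    then show ?thesis
      using c by (simp add: z_def scaleR_sum_right[symmetric])
  qed
  \<comment> \<open>The diameter of \<open>z\<close> gives the scale at which finiteness of
    \<open>omega\<close> is used; it does not depend on \<open>k\<close>, so neither does
    \<open>L\<close>.\<close>
  have zb: "norm (z m - z n) \<le> 4 * b / c" for m n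
  proof -
    have "norm (z m - z n) = (2 / c) * norm (x (r m) - x (r n))"
      using c by (simp add: z_def scaleR_diff_right[symmetric])
    also have "\<dots> \<le> (2 / c) * (2 * b)"
      using norm_triangle_ineq4[of "x (r m)" "x (r n)"] b[of "r m"] b[of "r n"] c
      by (intro mult_left_mono) auto
    finally show ?thesis by simp
  qed
  have "0 \<le> b" using b[of 0] norm_ge_zero order_trans by blast
  then have "omega f (4 * b / c) < \<infinity>" using f c by (simp add: coarse_embedding_def)
  then obtain L where L: "0 < L" "\<And>u v. norm (u - v) \<le> 4 * b / c \<Longrightarrow> norm (f u - f v) \<le> L"
    using omega_finite_bound by blast
  have Lz: "norm (f (u + z m) - f (u + z n)) \<le> L" for m n u
    using zb[of m n] by (intro L(2)) simp
  obtain C where C: "0 < C" "\<And>t. t \<in> {0..1} \<Longrightarrow> aus_modulus TYPE('b) t \<le> ereal (C * t powr q)"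
    using assms(7) unfolding asympt_unif_smooth_def by blast
  define D where "D = 2 * ((2 + 2 * C) * L)"
  \<comment> \<open>A bound uniform in \<open>k\<close> contradicts the infinite limit superior. The
    index 0, where the denominator vanishes, is excluded.\<close>
  have "rho f (real k powr (1 / p)) / ereal (real k powr (1 / q)) \<le> ereal D" if k: "1 \<le> k" for k
  proof -
    have "rho f (real k powr (1 / p)) \<le> ereal (D * real k powr (1 / q))"
      unfolding D_def by (rule rho_bound[where z = z]) (use assms(2,6) C z zlow L(1) Lz k in auto)
    then have "rho f (real k powr (1 / p)) / ereal (real k powr (1 / q))
        \<le> ereal (D * real k powr (1 / q)) / ereal (real k powr (1 / q))"
      using k by (intro ereal_divide_right_mono) auto
    then show ?thesis using k by simp
  qed
  then have "\<forall>\<^sub>F k in sequentially. rho f (real k powr (1 / p)) / ereal (real k powr (1 / q)) \<le> ereal D"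
    unfolding eventually_sequentially by blast
  then have "limsup (\<lambda>k. rho f (real k powr (1 / p)) / ereal (real k powr (1 / q))) \<le> ereal D"
    by (rule Limsup_bounded)
  then show False using lim by simp
qed

end
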